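(* Let $\gamma$ be a curve, parametrized by arclength $t\in[0,\infty)$, in a CAT(0) space $X$, with total curvature function $\tau(t)$ and circumradius function $c(t)$. Suppose $\gamma$ has finite total curvature $\tau_\gamma=\lim_{t\to\infty}\tau(t)$. Then: (a) Through any point $p\in X$ there is a geodesic ray $\sigma$ such that $d(\gamma(t),\sigma)\in o(t)$. (b) The circumradius function satisfies $c\in\Omega(t)$. (c) If $\int_0^\infty(\tau_\gamma-\tau(t))\,dt<\infty$, then $\gamma$ and $\sigma$ are asymptotic, i.e. $d(\gamma(t),\sigma)$ is bounded.
   Context: A CAT(0) space is a geodesic metric space in which the distance between any two points of any geodesic triangle is at most the distance between the corresponding points of the triangle with the same sidelengths in the Euclidean plane. The angle in $[0,\pi]$ between two geodesic segments from a common point is the limit (= infimum) of the corresponding angles in Euclidean model triangles for initial subsegments. A geodesic ray is a curve $\sigma:[0,\infty)\to X$ with $d(\sigma(s),\sigma(s'))=|s-s'|$ for all $s,s'$; $d(x,\sigma)$ is the distance from $x$ to the image of $\sigma$. Total curvature: a polygonal curve is a piecewise-geodesic curve. The total rotation of a polygonal curve $\sigma$ is $\tau_\sigma=\sum_i(\pi-\beta_i)$, where the $\beta_i\ge 0$ are the angles at its interior vertices. The total curvature $\tau_\gamma$ of a curve $\gamma$ is the $\limsup$ of $\tau_\sigma$ as $\mu_\sigma\to0$, over all polygonal curves $\sigma$ inscribed in $\gamma$, where $\mu_\sigma$ is the maximum segment length of $\sigma$. (In a CAT(0) space this equals the supremum of $\tau_\sigma$ over all inscribed polygonal $\sigma$.)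 The total curvature function is $\tau(t)=\tau_{\gamma|_{[0,t]}}$. The circumradius function is $c(t)$ = the smallest number such that $\gamma|_{[0,t]}$ lies in the ball of radius $c(t)$ about $\gamma(0)$. $c\in\Omega(t)$ means $c(t)\ge Ct$ for some constant $C>0$ and all sufficiently large $t$; $f\in o(t)$ means $f(t)/t\to0$ as $t\to\infty$.
   Formalization: Part (a) is stated for complete X: without completeness it fails, e.g. in the planar set {0≤y<1}∪{(0,1)} with γ(t)=(t,0), no geodesic ray passes through p=(0,1). Parts (b) and (c) need no completeness. *)

theory Defs
  imports "HOL-Analysis.Analysis" "HOL-Library.Landau_Symbols"
begin

definition geodesic_segment :: "(real \<Rightarrow> 'a::metric_space) \<Rightarrow> 'a \<Rightarrow> 'a \<Rightarrow> bool" where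
  "geodesic_segment g x y \<longleftrightarrow>
     g 0 = x \<and> g (dist x y) = y \<and>
     (\<forall>s\<in>{0..dist x y}. \<forall>t\<in>{0..dist x y}. dist (g s) (g t) = \<bar>s - t\<bar>)"

definition geodesic_ray :: "(real \<Rightarrow> 'a::metric_space) \<Rightarrow> bool" where
  "geodesic_ray \<sigma> \<longleftrightarrow> (\<forall>s\<ge>0. \<forall>t\<ge>0. dist (\<sigma> s) (\<sigma> t) = \<bar>s - t\<bar>)"

(* Points on one and the same side of a triangle are at the same distance as their comparison
   points, and any two sides share a vertex, here called x; so it suffices to compare a point of
   a side from x to y with a point of a side from x to z.  Completeness is not required. *)
class cat0_space = metric_space +
  assumes geodesic_segment_exists: "\<exists>g. geodesic_segment g x y"
    and triangle_comparison:
      "\<lbrakk>geodesic_segment g x y; geodesic_segment h x z;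
        dist x' y' = dist x y; dist x' z' = dist x z; dist y' z' = dist y z;
        s \<in> {0..dist x y}; p' \<in> closed_segment x' y'; dist x' p' = s;
        t \<in> {0..dist x z}; q' \<in> closed_segment x' z'; dist x' q' = t\<rbrakk>
       \<Longrightarrow> dist (g s) (h t) \<le> dist (p' :: real^2) q'"

(* Angle at the vertex corresponding to x in the Euclidean model triangle, by the law of cosines. *)
definition comparison_angle :: "'a::metric_space \<Rightarrow> 'a \<Rightarrow> 'a \<Rightarrow> real" where
  "comparison_angle x y z =
     arccos (((dist x y)\<^sup>2 + (dist x z)\<^sup>2 - (dist y z)\<^sup>2) / (2 * dist x y * dist x z))"

lemma comparison_angle_euclidean:
  fixes x y z :: "'a::real_inner"
  shows "comparison_angle x y z = arccos ((y - x) \<bullet> (z - x) / (norm (y - x) * norm (z - x)))"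
proof -
  have "(dist y z)\<^sup>2 = (norm ((y - x) - (z - x)))\<^sup>2"
    by (simp add: dist_norm)
  also have "\<dots> = (dist x y)\<^sup>2 + (dist x z)\<^sup>2 - 2 * ((y - x) \<bullet> (z - x))"
    unfolding power2_norm_eq_inner dist_norm norm_minus_commute[of x]
    by (simp add: inner_diff inner_commute)
  finally show ?thesis
    by (simp add: comparison_angle_def dist_norm norm_minus_commute[of x])
qed

(* Only used for geodesic segments of positive length with g 0 = h 0. *)
definition angle :: "(real \<Rightarrow> 'a::metric_space) \<Rightarrow> (real \<Rightarrow> 'a) \<Rightarrow> real" where
  "angle g h =
     Lim (at_right 0 \<times>\<^sub>F at_right 0) (\<lambda>(s, t). comparison_angle (g 0) (g s) (h t))"

(* In a CAT(0) space the segment is unique (on the interval from 0 to dist x y). *)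
definition segment_between :: "'a::metric_space \<Rightarrow> 'a \<Rightarrow> real \<Rightarrow> 'a" where
  "segment_between x y = (SOME g. geodesic_segment g x y)"

definition vertex_angle :: "'a::metric_space \<Rightarrow> 'a \<Rightarrow> 'a \<Rightarrow> real" where
  "vertex_angle x y z = angle (segment_between x y) (segment_between x z)"

(* A polygonal curve is represented by the list of its successive vertices. *)
definition total_rotation :: "'a::metric_space list \<Rightarrow> real" where
  "total_rotation vs = (\<Sum>i<length vs - 2. pi - vertex_angle (vs ! (i+1)) (vs ! i) (vs ! (i+2)))"

definition max_segment_length :: "'a::metric_space list \<Rightarrow> real" where
  "max_segment_length vs = Max (insert 0 {dist (vs ! i) (vs ! (i+1)) |i. i + 1 < length vs})"

definition partitions :: "real \<Rightarrow> real \<Rightarrow> real list set" where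
  "partitions a b = {ts. ts \<noteq> [] \<and> sorted_wrt (<) ts \<and> hd ts = a \<and> last ts = b}"

(* Consecutive vertices are distinct, so that all segments are nondegenerate and the angles
   between them are meaningful; vertices may otherwise repeat. *)
definition inscribed_polygons :: "(real \<Rightarrow> 'a::metric_space) \<Rightarrow> real \<Rightarrow> real \<Rightarrow> 'a list set" where
  "inscribed_polygons \<gamma> a b = {map \<gamma> ts |ts. ts \<in> partitions a b \<and> distinct_adj (map \<gamma> ts)}"

(* The filter expresses that max_segment_length vs tends to 0 over the inscribed polygons vs. *)
definition total_curvature :: "(real \<Rightarrow> 'a::metric_space) \<Rightarrow> real \<Rightarrow> real \<Rightarrow> ereal" where
  "total_curvature \<gamma> a b =
     Limsup (inf (filtercomap max_segment_length (nhds 0)) (principal (inscribed_polygons \<gamma> a b)))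
       (\<lambda>vs. ereal (total_rotation vs))"

definition curve_length :: "(real \<Rightarrow> 'a::metric_space) \<Rightarrow> real \<Rightarrow> real \<Rightarrow> ereal" where
  "curve_length \<gamma> a b =
     (SUP ts\<in>partitions a b. ereal (\<Sum>i<length ts - 1. dist (\<gamma> (ts ! i)) (\<gamma> (ts ! (i+1)))))"

definition arclength_parametrized :: "(real \<Rightarrow> 'a::metric_space) \<Rightarrow> bool" where
  "arclength_parametrized \<gamma> \<longleftrightarrow>
     (\<forall>s t. 0 \<le> s \<and> s \<le> t \<longrightarrow> curve_length \<gamma> s t = ereal (t - s))"

definition circumradius :: "(real \<Rightarrow> 'a::metric_space) \<Rightarrow> real \<Rightarrow> real" where
  "circumradius \<gamma> t = (LEAST r. \<gamma> ` {0..t} \<subseteq> cball (\<gamma> 0) r)"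

definition dist_to_ray :: "'a::metric_space \<Rightarrow> (real \<Rightarrow> 'a) \<Rightarrow> real" where
  "dist_to_ray x \<sigma> = infdist x (\<sigma> ` {0..})"

end

theory Submission
  imports Defs
begin

text \<open>
  Write \<open>K(s)\<close> for \<open>\<tau>\<^sub>\<gamma> - \<tau>(s)\<close>, the curvature that is left after time \<open>s\<close>.  It decreases to \<open>0\<close>.

  \<^bold>\<open>From curvature to polygons.\<close>  In a CAT(0) space a new vertex never lowers the total rotation of a
  polygon (\<open>total_rotation_insert\<close>), so every inscribed polygon, however coarse, has at most the
  total rotation of arbitrarily fine ones; the upper limit that defines the total curvature is a
  supremum (\<open>total_rotation_le_total_curvature\<close>).  Joining polygons at a common vertex gives
  superadditivity, and hence every polygon inscribed in the curve from time \<open>s\<close> on has total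
  rotation at most \<open>K(s)\<close> (\<open>total_rotation_le_remaining_curvature\<close>).  All the rest of the argument
  uses only this bound.

  \<^bold>\<open>Polygons seen from a point.\<close>  Let \<open>v\<^sub>0, v\<^sub>1, \<dots>\<close> be the vertices of a polygon with exterior angles
  \<open>\<rho>\<^sub>i\<close> at \<open>v\<^sub>i\<close>, and \<open>p\<close> a point.  Put \<open>r\<^sub>i = d(p, v\<^sub>i)\<close>, let \<open>u\<^sub>i\<close> be the angle at which the edge
  leaving \<open>v\<^sub>i\<close> deviates from the direction radially away from \<open>p\<close>, and \<open>\<phi>\<^sub>i\<close> the angle at \<open>p\<close> in the
  model triangle of \<open>p, v\<^sub>i, v\<^sub>i\<^sub>+\<^sub>1\<close>.  Comparison with this Euclidean triangle gives
  \<open>u\<^sub>i\<^sub>+\<^sub>1 \<le> u\<^sub>i + \<rho>\<^sub>i\<^sub>+\<^sub>1\<close> from its angle sum,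
  \<open>r\<^sub>i\<^sub>+\<^sub>1 u\<^sub>i\<^sub>+\<^sub>1 \<le> r\<^sub>i u\<^sub>i + r\<^sub>i\<^sub>+\<^sub>1 \<rho>\<^sub>i\<^sub>+\<^sub>1\<close> from its law of sines, and \<open>\<phi>\<^sub>i \<le> u\<^sub>i\<close>
  (\<open>exterior_angle_step\<close>, \<open>weighted_exterior_angle_step\<close>, \<open>comparison_angle_le_exterior_angle\<close>).

  \<^bold>\<open>Linear growth.\<close>  With \<open>p = v\<^sub>0\<close> on the curve at time \<open>s\<close>, the first inequality keeps all
  \<open>u\<^sub>i\<close> at or below \<open>K(s)\<close>, so each edge increases the distance from \<open>p\<close> by at least \<open>cos K(s)\<close> times its
  length.  Once \<open>K(s) < \<pi>/2\<close>, chords are thus at least a fixed fraction of their arcs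
  (\<open>chord_ge_length\<close>), and (b) follows.

  \<^bold>\<open>The ray.\<close>  For any \<open>p\<close>, the second inequality for the polygon with vertices at times
  \<open>T < s < t\<close> bounds \<open>r\<^sub>s \<phi>\<close>, where \<open>\<phi>\<close> is the comparison angle at \<open>p\<close> between \<open>\<gamma>(s)\<close> and \<open>\<gamma>(t)\<close>, by
  \<open>\<pi> r\<^sub>T + r\<^sub>s K(T)\<close>.  As \<open>r\<^sub>s\<close> grows linearly and \<open>K(T)\<close> is small for
  late \<open>T\<close>, the angle \<open>\<phi>\<close> is small uniformly in \<open>t\<close>.  Hence the segments from \<open>p\<close> to
  \<open>\<gamma>(t)\<close> converge to a ray (\<open>segments_Cauchy\<close>), and the same bound passes to the distance of
  \<open>\<gamma>(s)\<close> from that ray (\<open>limit_ray_sublinear\<close>), which is (a).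

  \<^bold>\<open>Bounded distance.\<close>  A ray at sublinear distance from the curve is the limit of the segments
  from its own starting point to \<open>\<gamma>(t)\<close> (\<open>sublinear_ray_is_limit_ray\<close>).  Taking vertices at times
  \<open>T, T + 1, \<dots>, T + n\<close> and \<open>t\<close>, the second inequality bounds the distance of \<open>\<gamma>(T + n)\<close> from the ray by
  a constant plus \<open>\<Sum> j \<rho>\<^sub>j\<close>, and summation by parts turns this sum into one of values of \<open>K\<close> at
  unit steps, which is controlled by the integral of \<open>K\<close> (\<open>dist_to_limit_ray_bounded\<close>).  This is (c).
\<close>

section \<open>Euclidean model triangles\<close>

lemma cos_comparison_angle:
  fixes x y z :: "'a::metric_space"
  assumes "x \<noteq> y" "x \<noteq> z"
  shows "cos (comparison_angle x y z) =
    ((dist x y)\<^sup>2 + (dist x z)\<^sup>2 - (dist y z)\<^sup>2) / (2 * dist x y * dist x z)"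
proof -
  have pos: "dist x y > 0" "dist x z > 0" using assms by auto
  have "dist y z \<le> dist x y + dist x z" by (metis dist_commute dist_triangle)
  then have "(dist y z)\<^sup>2 \<le> (dist x y + dist x z)\<^sup>2" by (rule power_mono) simp
  moreover have "\<bar>dist x y - dist x z\<bar> \<le> dist y z"
    using dist_triangle[of x y z] dist_triangle[of x z y] by (auto simp: dist_commute)
  then have "(dist x y - dist x z)\<^sup>2 \<le> (dist y z)\<^sup>2" by (metis abs_ge_zero power2_abs power_mono)
  ultimately show ?thesis
    unfolding comparison_angle_def using pos
    by (intro cos_arccos) (simp_all add: field_simps power2_eq_square)
qed

lemma comparison_angle_bounds:
  fixes x y z :: "'a::metric_space"
  assumes "x \<noteq> y" "x \<noteq> z"
  shows "0 \<le> comparison_angle x y z" "comparison_angle x y z \<le> pi"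
proof -
  have "\<bar>((dist x y)\<^sup>2 + (dist x z)\<^sup>2 - (dist y z)\<^sup>2) / (2 * dist x y * dist x z)\<bar> \<le> 1"
    using cos_comparison_angle[OF assms] abs_cos_le_one[of "comparison_angle x y z"] by simp
  then have "-1 \<le> ((dist x y)\<^sup>2 + (dist x z)\<^sup>2 - (dist y z)\<^sup>2) / (2 * dist x y * dist x z)"
     "((dist x y)\<^sup>2 + (dist x z)\<^sup>2 - (dist y z)\<^sup>2) / (2 * dist x y * dist x z) \<le> 1"
    by linarith+
  then show "0 \<le> comparison_angle x y z" "comparison_angle x y z \<le> pi"
    unfolding comparison_angle_def by (auto intro: arccos_lbound arccos_ubound)
qed

lemma comparison_angle_commute: "comparison_angle x y z = comparison_angle x z y"
  by (simp add: comparison_angle_def dist_commute algebra_simps)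

lemma law_of_cosines:
  fixes x y z :: "'a::metric_space"
  assumes "x \<noteq> y" "x \<noteq> z"
  shows "(dist y z)\<^sup>2 =
    (dist x y)\<^sup>2 + (dist x z)\<^sup>2 - 2 * dist x y * dist x z * cos (comparison_angle x y z)"
  using assms by (simp add: cos_comparison_angle)

lemma comparison_angle_le_iff:
  fixes x y z :: "'a::metric_space"
  assumes "x \<noteq> y" "x \<noteq> z" "0 \<le> \<theta>" "\<theta> \<le> pi"
  shows "comparison_angle x y z \<le> \<theta> \<longleftrightarrow>
    (dist y z)\<^sup>2 \<le> (dist x y)\<^sup>2 + (dist x z)\<^sup>2 - 2 * dist x y * dist x z * cos \<theta>"
proof -
  have "comparison_angle x y z \<le> \<theta> \<longleftrightarrow> cos \<theta> \<le> cos (comparison_angle x y z)"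
    using comparison_angle_bounds[OF assms(1,2)] assms(3,4) by (simp add: cos_mono_le_eq)
  also have "\<dots> \<longleftrightarrow> dist x y * dist x z * cos \<theta> \<le> dist x y * dist x z * cos (comparison_angle x y z)"
    using assms by (intro mult_le_cancel_left_pos[symmetric]) simp
  finally show ?thesis using law_of_cosines[OF assms(1,2)] by auto
qed

text \<open>Twice the area of the model triangle, in Heron's form: symmetric in the three vertices.\<close>

definition model_area :: "'a::metric_space \<Rightarrow> 'a \<Rightarrow> 'a \<Rightarrow> real" where
  "model_area x y z = sqrt (4 * (dist x y)\<^sup>2 * (dist x z)\<^sup>2
     - ((dist x y)\<^sup>2 + (dist x z)\<^sup>2 - (dist y z)\<^sup>2)\<^sup>2) / 2"

lemma model_area_rotate: "model_area x y z = model_area y z x"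
  by (simp add: model_area_def dist_commute algebra_simps power2_eq_square)

lemma model_area_swap: "model_area x y z = model_area x z y"
  by (simp add: model_area_def dist_commute algebra_simps power2_eq_square)

lemma model_area_eq_sin:
  fixes x y z :: "'a::metric_space"
  assumes "x \<noteq> y" "x \<noteq> z"
  shows "model_area x y z = dist x y * dist x z * sin (comparison_angle x y z)"
proof -
  let ?a = "dist x y" and ?b = "dist x z" and ?t = "comparison_angle x y z"
  have "4 * ?a\<^sup>2 * ?b\<^sup>2 - (?a\<^sup>2 + ?b\<^sup>2 - (dist y z)\<^sup>2)\<^sup>2 = (2 * ?a * ?b * sin ?t)\<^sup>2"
    by (simp add: law_of_cosines[OF assms] power_mult_distrib sin_squared_eq algebra_simps)
  moreover have "sin ?t \<ge> 0"
    using comparison_angle_bounds[OF assms] by (intro sin_ge_zero)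
  ultimately show ?thesis by (simp add: model_area_def real_sqrt_abs abs_mult)
qed

text \<open>
  \<open>model_area\<close> expresses the three sines and the law of cosines the three cosines.  The addition
  formulas then show that the sum of the angles is an odd multiple of \<open>\<pi>\<close>, and its range leaves only
  \<open>\<pi>\<close> and \<open>3 \<pi>\<close>.  The latter would make all angles straight.
\<close>

lemma comparison_angle_sum:
  fixes x y z :: "'a::metric_space"
  assumes "x \<noteq> y" "x \<noteq> z" "y \<noteq> z"
  shows "comparison_angle x y z + comparison_angle y x z + comparison_angle z x y = pi"
proof -
  define A B C where "A = comparison_angle x y z" and "B = comparison_angle y x z"
    and "C = comparison_angle z x y"
  define a b c where "a = dist y z" and "b = dist x z" and "c = dist x y"
  define S where "S = model_area x y z"
  have pos: "a > 0" "b > 0" "c > 0" using assms by (auto simp: a_def b_def c_def)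
  have bd: "0 \<le> A" "A \<le> pi" "0 \<le> B" "B \<le> pi" "0 \<le> C" "C \<le> pi"
    using assms by (simp_all add: A_def B_def C_def comparison_angle_bounds)
  have sinA: "sin A = S / (b * c)"
    using model_area_eq_sin[of x y z] assms pos by (simp add: A_def S_def b_def c_def)
  have sinB: "sin B = S / (a * c)"
    using model_area_eq_sin[of y x z] assms pos model_area_rotate[of x y z] model_area_swap[of y x z]
    by (simp add: B_def S_def a_def c_def dist_commute)
  have sinC: "sin C = S / (a * b)"
    using model_area_eq_sin[of z x y] assms pos model_area_rotate[of z x y]
    by (simp add: C_def S_def a_def b_def dist_commute)
  have cosA: "cos A = (b\<^sup>2 + c\<^sup>2 - a\<^sup>2) / (2 * b * c)"
    using cos_comparison_angle[of x y z] assms by (simp add: A_def a_def b_def c_def dist_commute algebra_simps)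
  have cosB: "cos B = (a\<^sup>2 + c\<^sup>2 - b\<^sup>2) / (2 * a * c)"
    using cos_comparison_angle[of y x z] assms by (simp add: B_def a_def b_def c_def dist_commute algebra_simps)
  have cosC: "cos C = (a\<^sup>2 + b\<^sup>2 - c\<^sup>2) / (2 * a * b)"
    using cos_comparison_angle[of z x y] assms by (simp add: C_def a_def b_def c_def dist_commute algebra_simps)
  have s: "sin (A + B) = sin C"
    unfolding sin_add sinA sinB sinC cosA cosB using pos by (simp add: field_simps power2_eq_square)
  have "S\<^sup>2 = (b * c * sin A)\<^sup>2" using sinA pos by simp
  also have "\<dots> = (b * c)\<^sup>2 * (1 - (cos A)\<^sup>2)" by (simp add: power_mult_distrib sin_squared_eq)
  also have "\<dots> = b\<^sup>2 * c\<^sup>2 - (b\<^sup>2 + c\<^sup>2 - a\<^sup>2)\<^sup>2 / 4"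
    unfolding cosA using pos by (simp add: field_simps)
  finally have S2: "S\<^sup>2 = b\<^sup>2 * c\<^sup>2 - (b\<^sup>2 + c\<^sup>2 - a\<^sup>2)\<^sup>2 / 4" .
  have "sin A * sin B = S\<^sup>2 / (a * b * c\<^sup>2)" 
    unfolding sinA sinB using pos by (simp add: field_simps power2_eq_square)
  then have "cos (A + B) = cos A * cos B - S\<^sup>2 / (a * b * c\<^sup>2)"
    by (simp only: cos_add)
  also have "\<dots> = - cos C"
    unfolding S2 cosA cosB cosC using pos by (simp add: field_simps power2_eq_square)
  finally have c: "cos (A + B) = - cos C" .
  have ct: "cos (A + B + C) = -1" 
    using sin_cos_squared_add[of C] unfolding cos_add[of "A + B"] s c by (simp add: power2_eq_square)
  have st: "sin (A + B + C) = 0" unfolding sin_add[of "A + B"] s c by simp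
  have "A + B + C \<noteq> 3 * pi"
  proof
    assume "A + B + C = 3 * pi"
    then have "A = pi" "B = pi" using bd by auto
    then have "b\<^sup>2 + c\<^sup>2 - a\<^sup>2 = - 2 * b * c" "a\<^sup>2 + c\<^sup>2 - b\<^sup>2 = - 2 * a * c" 
      using cosA cosB pos by (simp_all add: field_simps)
    then have "c * (c + a + b) = 0" by algebra
    then show False using pos by simp
  qed
  moreover obtain n :: int where n: "A + B + C = of_int n * pi" using st by (auto simp: sin_zero_iff_int2)
  moreover have "n \<ge> 0" "n \<le> 3"
  proof -
    have 1: "0 * pi \<le> of_int n * pi" and 2: "of_int n * pi \<le> 3 * pi"
      using bd unfolding n[symmetric] by auto
    show "n \<ge> 0" using mult_right_le_imp_le[OF 1] by simp
    show "n \<le> 3" using mult_right_le_imp_le[OF 2] by simp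
  qed
  moreover have "n \<noteq> 0" "n \<noteq> 2" using ct n by auto
  ultimately have "n = 1" by (cases "n = 3") auto
  then show ?thesis using n by (simp add: A_def B_def C_def)
qed

lemma mult_sin_le_mult_sin:
  fixes x y :: real
  assumes "0 \<le> x" "x \<le> y" "y \<le> pi"
  shows "x * sin y \<le> y * sin x"
proof (cases "y = 0")
  case False
  have "convex_on {0..pi} (\<lambda>x. - sin x)"
    by (rule f''_ge0_imp_convex[where f' = "\<lambda>x. - cos x" and f'' = sin])
      (auto intro!: derivative_eq_intros sin_ge_zero)
  then have "- sin ((1 - x / y) *\<^sub>R 0 + (x / y) *\<^sub>R y) \<le> (1 - x / y) * (- sin 0) + x / y * (- sin y)"
    by (rule convex_onD) (use assms False in auto)
  then show ?thesis using assms False by (simp add: field_simps)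
qed (use assms in auto)

text \<open>
  Let \<open>B\<close> be the angle at \<open>y\<close> and \<open>U\<close> the exterior angle at \<open>x\<close> of the model triangle, so
  \<open>B \<le> U\<close>.  By the law of sines \<open>d(p, y) sin B = d(p, x) sin U\<close>, and since \<open>sin \<theta> / \<theta>\<close> decreases on
  \<open>(0, \<pi>]\<close>, replacing the sines by the angles makes the left hand side no larger than the right hand
  side.  This is the planar fact that, along a straight line, the product of the distance from \<open>p\<close>
  and the deviation from the radial direction does not increase.
\<close>

lemma mult_comparison_angle_le:
  fixes p x y :: "'a::metric_space"
  assumes "p \<noteq> x" "p \<noteq> y" "x \<noteq> y"
  shows "dist p y * comparison_angle y p x \<le> dist p x * (pi - comparison_angle x p y)"
proof -
  define B U where "B = comparison_angle y p x" and "U = pi - comparison_angle x p y"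
  have bd: "0 \<le> B" "B \<le> U" "U \<le> pi"
  proof -
    have "comparison_angle x p y + comparison_angle p x y + comparison_angle y x p = pi"
      by (rule comparison_angle_sum) (use assms in auto)
    moreover have "comparison_angle y x p = B" unfolding B_def by (rule comparison_angle_commute)
    moreover have "0 \<le> comparison_angle p x y" "0 \<le> B" "0 \<le> comparison_angle x p y"
      using assms by (simp_all add: B_def comparison_angle_bounds)
    ultimately show "0 \<le> B" "B \<le> U" "U \<le> pi" unfolding U_def by linarith+
  qed
  have "dist y p * dist y x * sin B = model_area y p x"
    unfolding B_def by (rule model_area_eq_sin[symmetric]) (use assms in auto)
  also have "\<dots> = model_area x p y"
    using model_area_rotate[of y p x] model_area_rotate[of p x y] model_area_swap[of x p y] by metis
  also have "\<dots> = dist x p * dist x y * sin (comparison_angle x p y)"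
    by (rule model_area_eq_sin) (use assms in auto)
  also have "sin (comparison_angle x p y) = sin U" by (simp add: U_def)
  finally have "dist x y * (dist p y * sin B) = dist x y * (dist p x * sin U)"
    by (simp only: dist_commute mult_ac)
  then have sines: "dist p y * sin B = dist p x * sin U" using assms by simp
  have mono: "B * sin U \<le> U * sin B" using bd by (intro mult_sin_le_mult_sin)
  show ?thesis
  proof (cases "sin U = 0")
    case False
    then have "sin U > 0" using sin_ge_zero[of U] bd by linarith
    moreover have "dist p y * B * sin U \<le> dist p x * U * sin U"
    proof -
      have "dist p y * B * sin U = dist p y * (B * sin U)" by (simp only: mult.assoc)
      also have "\<dots> \<le> dist p y * (U * sin B)" by (rule mult_left_mono[OF mono]) simp
      also have "\<dots> = U * (dist p y * sin B)" by (simp only: mult_ac)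
      also have "\<dots> = dist p x * U * sin U" unfolding sines by (simp only: mult_ac)
      finally show ?thesis .
    qed
    ultimately show ?thesis unfolding B_def[symmetric] U_def[symmetric] 
      by (rule mult_right_le_imp_le[rotated])
  next
    case True
    then have "sin B = 0" using sines assms by simp
    then have "B = 0 \<or> B = pi"
      using bd sin_gt_zero[of B] by linarith
    then show ?thesis
    proof
      assume "B = 0"
      then show ?thesis using bd by (simp add: B_def[symmetric] U_def[symmetric])
    next
      assume B: "B = pi"
      then have "comparison_angle y p x = pi" by (simp only: B_def)
      then have "(dist p x)\<^sup>2 = (dist p y + dist x y)\<^sup>2"
        using law_of_cosines[of y p x] assms
        unfolding power2_sum by (simp add: dist_commute)
      then have "dist p x = dist p y + dist x y"
        by (simp only: power2_eq_iff_nonneg zero_le_dist add_nonneg_nonneg)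
      moreover have "U = pi" using B bd by simp
      ultimately show ?thesis unfolding B_def[symmetric] U_def[symmetric] B by simp
    qed
  qed
qed

section \<open>Angles in a CAT(0) space\<close>

lemma geodesic_segment_segment_between:
  fixes x y :: "'a::cat0_space"
  shows "geodesic_segment (segment_between x y) x y"
  unfolding segment_between_def using geodesic_segment_exists by (rule someI_ex)

lemma segment_dist:
  fixes x y :: "'a::cat0_space"
  assumes "0 \<le> r" "r \<le> dist x y" "0 \<le> r'" "r' \<le> dist x y"
  shows "dist (segment_between x y r) (segment_between x y r') = \<bar>r - r'\<bar>"
  using geodesic_segment_segment_between[of x y] assms by (auto simp: geodesic_segment_def)

lemma segment_ends:
  fixes x y :: "'a::cat0_space"
  shows "segment_between x y 0 = x" "segment_between x y (dist x y) = y"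
  using geodesic_segment_segment_between[of x y] by (auto simp: geodesic_segment_def)

lemma geodesic_segment_dist:
  assumes "geodesic_segment g x y" "0 \<le> s" "s \<le> dist x y"
  shows "dist x (g s) = s"
proof -
  have "dist (g 0) (g s) = \<bar>0 - s\<bar>"
    using assms unfolding geodesic_segment_def by (metis atLeastAtMost_iff order_refl order_trans)
  then show ?thesis using assms by (simp add: geodesic_segment_def)
qed

lemma geodesic_segment_initial:
  assumes "geodesic_segment g x y" "0 \<le> s" "s \<le> dist x y"
  shows "geodesic_segment g x (g s)"
  using assms geodesic_segment_dist[OF assms] by (auto simp: geodesic_segment_def)

text \<open>
  The model triangle with the vertex of \<open>x\<close> at the origin of the plane turns the comparison
  axiom into a bound in terms of the comparison angle alone.
\<close>

lemma dist_geodesics_le: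
  fixes x y z :: "'a::cat0_space"
  assumes g: "geodesic_segment g x y" and h: "geodesic_segment h x z"
    and ne: "x \<noteq> y" "x \<noteq> z"
    and s: "0 \<le> s" "s \<le> dist x y" and t: "0 \<le> t" "t \<le> dist x z"
  shows "(dist (g s) (h t))\<^sup>2 \<le> s\<^sup>2 + t\<^sup>2 - 2 * s * t * cos (comparison_angle x y z)"
proof -
  define \<theta> where "\<theta> = comparison_angle x y z"
  define e f :: "real^2" where "e = vector [1, 0]" and "f = vector [cos \<theta>, sin \<theta>]"
  have ee: "e \<bullet> e = 1" "f \<bullet> f = 1" "e \<bullet> f = cos \<theta>" "f \<bullet> e = cos \<theta>"
    by (simp_all add: e_def f_def inner_vec_def sum_2 flip: power2_eq_square)
  have ne1: "norm e = 1" "norm f = 1" using ee by (simp_all add: norm_eq_1)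
  have d2: "(dist (a *\<^sub>R e) (b *\<^sub>R f))\<^sup>2 = a\<^sup>2 + b\<^sup>2 - 2 * a * b * cos \<theta>" for a b
    unfolding dist_norm power2_norm_eq_inner
    by (simp add: inner_diff ee power2_eq_square algebra_simps)
  define y' z' where "y' = dist x y *\<^sub>R e" and "z' = dist x z *\<^sub>R f"
  have "(dist y' z')\<^sup>2 = (dist y z)\<^sup>2"
    unfolding y'_def z'_def d2 \<theta>_def by (rule law_of_cosines[symmetric, OF ne])
  then have yz: "dist y' z' = dist y z" by (simp only: power2_eq_iff_nonneg zero_le_dist)
  have "s *\<^sub>R e \<in> closed_segment 0 y'" 
    unfolding closed_segment_def using s ne
    by (auto simp: y'_def intro!: exI[of _ "s / dist x y"])
  moreover have "t *\<^sub>R f \<in> closed_segment 0 z'" 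
    unfolding closed_segment_def using t ne
    by (auto simp: z'_def intro!: exI[of _ "t / dist x z"])
  ultimately have "dist (g s) (h t) \<le> dist (s *\<^sub>R e) (t *\<^sub>R f)"
    using s t yz by (intro triangle_comparison[OF g h, where x' = 0 and y' = y' and z' = z'])
      (auto simp: y'_def z'_def ne1)
  then have "(dist (g s) (h t))\<^sup>2 \<le> (dist (s *\<^sub>R e) (t *\<^sub>R f))\<^sup>2" by (intro power_mono) auto
  then show ?thesis unfolding d2 \<theta>_def .
qed

text \<open>
  Initial parts of geodesic segments are geodesic segments, so the comparison of distances applies
  to the smaller pair of points inside the triangle of the larger pair.
\<close>

lemma comparison_angle_mono:
  fixes x y z :: "'a::cat0_space"
  assumes g: "geodesic_segment g x y" and h: "geodesic_segment h x z"
    and s: "0 < s" "s \<le> s'" "s' \<le> dist x y" and t: "0 < t" "t \<le> t'" "t' \<le> dist x z"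
  shows "comparison_angle x (g s) (h t) \<le> comparison_angle x (g s') (h t')"
proof -
  have d: "dist x (g s) = s" "dist x (g s') = s'" "dist x (h t) = t" "dist x (h t') = t'"
    using s t by (auto intro!: geodesic_segment_dist[OF g] geodesic_segment_dist[OF h])
  have ne: "x \<noteq> g s" "x \<noteq> g s'" "x \<noteq> h t" "x \<noteq> h t'" using d s t by auto
  have "(dist (g s) (h t))\<^sup>2 \<le> s\<^sup>2 + t\<^sup>2 - 2 * s * t * cos (comparison_angle x (g s') (h t'))"
    using s t d ne
    by (intro dist_geodesics_le geodesic_segment_initial[OF g] geodesic_segment_initial[OF h]) auto
  then show ?thesis
    using comparison_angle_le_iff[OF ne(1,3)] comparison_angle_bounds[OF ne(2,4)] d by simp
qed

lemma dist_geodesics_le_proportional: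
  fixes x y z :: "'a::cat0_space"
  assumes g: "geodesic_segment g x y" and h: "geodesic_segment h x z"
    and ne: "x \<noteq> y" "x \<noteq> z" and c: "0 \<le> c" "c \<le> 1"
  shows "dist (g (c * dist x y)) (h (c * dist x z)) \<le> c * dist y z"
proof -
  have "(dist (g (c * dist x y)) (h (c * dist x z)))\<^sup>2 \<le> (c * dist x y)\<^sup>2 + (c * dist x z)\<^sup>2
      - 2 * (c * dist x y) * (c * dist x z) * cos (comparison_angle x y z)"
    using c by (intro dist_geodesics_le[OF g h ne]) (auto simp: mult_left_le_one_le)
  also have "\<dots> = (c * dist y z)\<^sup>2"
    unfolding power_mult_distrib[of c "dist y z"] law_of_cosines[OF ne]
    by (simp add: power2_eq_square algebra_simps)
  finally show ?thesis by (rule power2_le_imp_le) (use c in simp)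
qed

text \<open>A chord of a circle is at most as long as its arc.\<close>

lemma dist_geodesics_same_radius_le:
  fixes x y z :: "'a::cat0_space"
  assumes g: "geodesic_segment g x y" and h: "geodesic_segment h x z"
    and ne: "x \<noteq> y" "x \<noteq> z" and r: "0 \<le> r" "r \<le> dist x y" "r \<le> dist x z"
  shows "dist (g r) (h r) \<le> r * comparison_angle x y z"
proof -
  let ?\<theta> = "comparison_angle x y z"
  have "(dist (g r) (h r))\<^sup>2 \<le> r\<^sup>2 + r\<^sup>2 - 2 * r * r * cos ?\<theta>"
    using r by (intro dist_geodesics_le[OF g h ne]) auto
  also have "\<dots> = (2 * r * sin (?\<theta> / 2))\<^sup>2"
    using cos_double_sin[of "?\<theta> / 2"]
    by (simp add: power_mult_distrib) (simp add: power2_eq_square algebra_simps)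
  also have "\<dots> \<le> (r * ?\<theta>)\<^sup>2"
  proof (rule power_mono)
    have "sin (?\<theta> / 2) \<le> ?\<theta> / 2"
      using comparison_angle_bounds[OF ne] by (intro sin_x_le_x) auto
    then show "2 * r * sin (?\<theta> / 2) \<le> r * ?\<theta>"
      using mult_left_mono[of "sin (?\<theta> / 2)" "?\<theta> / 2" "2 * r"] r by simp
    show "0 \<le> 2 * r * sin (?\<theta> / 2)"
      using comparison_angle_bounds[OF ne] r by (intro mult_nonneg_nonneg sin_ge_zero) auto
  qed
  finally show ?thesis
    by (rule power2_le_imp_le) (use r comparison_angle_bounds[OF ne] in simp)
qed

text \<open>
  By monotonicity the limit that defines an angle exists and is the infimum of the comparison
  angles of initial subsegments.
\<close>

lemma angle_tendsto:
  fixes x y z :: "'a::cat0_space"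
  assumes g: "geodesic_segment g x y" and h: "geodesic_segment h x z"
    and ne: "x \<noteq> y" "x \<noteq> z"
  shows "((\<lambda>(s, t). comparison_angle x (g s) (h t)) \<longlongrightarrow> angle g h) (at_right 0 \<times>\<^sub>F at_right 0)"
    and "\<lbrakk>0 < s; s \<le> dist x y; 0 < t; t \<le> dist x z\<rbrakk> \<Longrightarrow> angle g h \<le> comparison_angle x (g s) (h t)"
proof -
  define F where "F = (\<lambda>(s, t). comparison_angle x (g s) (h t))"
  define D where "D = {0<..dist x y} \<times> {0<..dist x z}"
  define L where "L = Inf (F ` D)"
  have D0: "(dist x y, dist x z) \<in> D" using ne by (auto simp: D_def)
  have F0: "0 \<le> F p" if "p \<in> D" for p
  proof -
    have "dist x (g (fst p)) = fst p" "dist x (h (snd p)) = snd p"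
      using that by (auto simp: D_def intro!: geodesic_segment_dist[OF g] geodesic_segment_dist[OF h])
    then have "x \<noteq> g (fst p)" "x \<noteq> h (snd p)" using that by (auto simp: D_def)
    then show ?thesis by (auto simp: F_def case_prod_beta intro: comparison_angle_bounds)
  qed
  have bdd: "bdd_below (F ` D)" using F0 by (auto intro!: bdd_belowI[of _ 0])
  have le: "L \<le> F p" if "p \<in> D" for p
    unfolding L_def using that bdd by (intro cInf_lower) auto
  have lim: "(F \<longlongrightarrow> L) (at_right 0 \<times>\<^sub>F at_right 0)"
  proof (rule tendstoI)
    fix e :: real assume "e > 0"
    then have "\<exists>v\<in>F ` D. v < L + e" 
      unfolding L_def using D0 by (intro cInf_lessD) auto
    then obtain s0 t0 where st: "(s0, t0) \<in> D" "F (s0, t0) < L + e" by auto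
    have "eventually (\<lambda>s. 0 < s \<and> s < s0) (at_right (0::real))"
      "eventually (\<lambda>t. 0 < t \<and> t < t0) (at_right (0::real))"
      using st(1) by (auto simp: D_def eventually_at_right_field intro: exI[of _ s0] exI[of _ t0])
    then have "eventually (\<lambda>p. (0 < fst p \<and> fst p < s0) \<and> (0 < snd p \<and> snd p < t0))
        (at_right 0 \<times>\<^sub>F at_right 0)"
      by (auto simp: eventually_prod_filter)
    then show "eventually (\<lambda>p. dist (F p) L < e) (at_right 0 \<times>\<^sub>F at_right 0)"
    proof eventually_elim
      case (elim p)
      then have "p \<in> D" using st(1) by (auto simp: D_def mem_Times_iff)
      moreover have "F p \<le> F (s0, t0)"
        using elim st(1) by (auto simp: F_def D_def case_prod_beta intro!: comparison_angle_mono[OF g h])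
      ultimately show ?case using le[of p] st(2) by (auto simp: dist_real_def)
    qed
  qed
  have g0: "g 0 = x" using g by (simp add: geodesic_segment_def)
  have "angle g h = L"
    unfolding angle_def g0 using lim
    by (intro tendsto_Lim) (auto simp: F_def prod_filter_eq_bot)
  then show "((\<lambda>(s, t). comparison_angle x (g s) (h t)) \<longlongrightarrow> angle g h) (at_right 0 \<times>\<^sub>F at_right 0)"
    and "\<lbrakk>0 < s; s \<le> dist x y; 0 < t; t \<le> dist x z\<rbrakk> \<Longrightarrow> angle g h \<le> comparison_angle x (g s) (h t)"
    using lim le[of "(s, t)"] by (auto simp: F_def D_def)
qed

lemma angle_nonneg:
  fixes x y z :: "'a::cat0_space"
  assumes g: "geodesic_segment g x y" and h: "geodesic_segment h x z"
    and ne: "x \<noteq> y" "x \<noteq> z"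
  shows "0 \<le> angle g h"
proof (rule tendsto_lowerbound[OF angle_tendsto(1)[OF assms]])
  have "eventually (\<lambda>s. 0 < s \<and> s < dist x y) (at_right (0::real))"
    "eventually (\<lambda>t. 0 < t \<and> t < dist x z) (at_right (0::real))"
    using ne by (auto simp: eventually_at_right_field intro: exI[of _ "dist x y"] exI[of _ "dist x z"])
  then have "eventually (\<lambda>p. (0 < fst p \<and> fst p < dist x y) \<and> (0 < snd p \<and> snd p < dist x z))
        (at_right 0 \<times>\<^sub>F at_right 0)"
    by (auto simp: eventually_prod_filter)
  then show "eventually (\<lambda>p. 0 \<le> (case p of (s, t) \<Rightarrow> comparison_angle x (g s) (h t)))
      (at_right 0 \<times>\<^sub>F at_right 0)"
  proof eventually_elim
    case (elim p)
    then have "dist x (g (fst p)) = fst p" "dist x (h (snd p)) = snd p"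
      by (auto intro!: geodesic_segment_dist[OF g] geodesic_segment_dist[OF h])
    then have "x \<noteq> g (fst p)" "x \<noteq> h (snd p)" using elim by auto
    then show ?case by (auto simp: case_prod_beta intro: comparison_angle_bounds)
  qed
qed (auto simp: prod_filter_eq_bot)

text \<open>
  The form in which the existence of the limit enters the triangle inequality for angles: a strict
  upper bound for the angle bounds all sufficiently small comparison angles.
\<close>

lemma angle_less_imp_comparison_angle_less:
  fixes x y z :: "'a::cat0_space"
  assumes g: "geodesic_segment g x y" and h: "geodesic_segment h x z"
    and ne: "x \<noteq> y" "x \<noteq> z" and less: "angle g h < \<alpha>"
  obtains d where "0 < d" "d \<le> dist x y" "d \<le> dist x z"
    "\<And>s t. \<lbrakk>0 < s; s \<le> d; 0 < t; t \<le> d\<rbrakk> \<Longrightarrow> comparison_angle x (g s) (h t) < \<alpha>"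
proof -
  have "eventually (\<lambda>p. (case p of (s, t) \<Rightarrow> comparison_angle x (g s) (h t)) < \<alpha>) (at_right 0 \<times>\<^sub>F at_right 0)"
    using angle_tendsto(1)[OF g h ne] less by (rule order_tendstoD)
  then obtain P Q where P: "eventually P (at_right (0::real))" "eventually Q (at_right (0::real))"
    and PQ: "\<And>s t. P s \<Longrightarrow> Q t \<Longrightarrow> comparison_angle x (g s) (h t) < \<alpha>"
    by (auto simp: eventually_prod_filter)
  obtain b c where b: "b > 0" "\<And>s. 0 < s \<Longrightarrow> s < b \<Longrightarrow> P s" and c: "c > 0" "\<And>s. 0 < s \<Longrightarrow> s < c \<Longrightarrow> Q s"
    using P by (auto simp: eventually_at_right_field)
  define d where "d = min (min (b / 2) (c / 2)) (min (dist x y) (dist x z))"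
  show ?thesis
  proof (rule that[of d])
    show "d > 0" "d \<le> dist x y" "d \<le> dist x z" using b c ne by (auto simp: d_def)
    fix s t assume "0 < s" "s \<le> d" "0 < t" "t \<le> d"
    then show "comparison_angle x (g s) (h t) < \<alpha>" using b c by (intro PQ) (auto simp: d_def)
  qed
qed

text \<open>
  If \<open>angle f h\<close> exceeded the sum, then for some \<open>\<alpha>\<close> and \<open>\<beta>\<close> with \<open>\<alpha> + \<beta> < \<pi>\<close>
  all small comparison angles between \<open>f\<close> and \<open>g\<close> would be below \<open>\<alpha>\<close>, those between \<open>g\<close> and \<open>h\<close>
  below \<open>\<beta>\<close>, and those between \<open>f\<close> and \<open>h\<close> above \<open>\<alpha> + \<beta>\<close>.  In the isosceles planar
  triangle with apex angle \<open>\<alpha> + \<beta>\<close> the ray that splits the apex angle meets the base; the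
  point of \<open>g\<close> at the same distance from the vertex then violates the triangle inequality.
\<close>

lemma angle_triangle:
  fixes x y z w :: "'a::cat0_space"
  assumes f: "geodesic_segment f x y" and g: "geodesic_segment g x z" and h: "geodesic_segment h x w"
    and ne: "x \<noteq> y" "x \<noteq> z" "x \<noteq> w"
  shows "angle f h \<le> angle f g + angle g h"
proof (rule ccontr)
  assume contr: "\<not> ?thesis"
  have fhpi: "angle f h \<le> pi"
    using angle_tendsto(2)[OF f h, of "dist x y" "dist x w"] ne f h
      comparison_angle_bounds[of x y w] by (auto simp: geodesic_segment_def)
  define \<delta> where "\<delta> = (angle f h - (angle f g + angle g h)) / 3"
  define \<alpha> \<beta> where "\<alpha> = angle f g + \<delta>" and "\<beta> = angle g h + \<delta>"
  have \<delta>: "\<delta> > 0" using contr by (simp add: \<delta>_def)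
  have \<alpha>: "angle f g < \<alpha>" and \<beta>: "angle g h < \<beta>" using \<delta> by (auto simp: \<alpha>_def \<beta>_def)
  have pos: "\<alpha> > 0" "\<beta> > 0"
    using \<alpha> \<beta> angle_nonneg[OF f g ne(1,2)] angle_nonneg[OF g h ne(2,3)] by auto
  have sum: "\<alpha> + \<beta> < angle f h" using \<delta> by (simp add: \<alpha>_def \<beta>_def \<delta>_def field_simps)
  then have lt: "\<alpha> < pi" "\<beta> < pi" "\<alpha> + \<beta> < pi" using fhpi pos by auto
  obtain d1 where d1: "0 < d1" "d1 \<le> dist x y" "d1 \<le> dist x z"
    "\<And>s t. \<lbrakk>0 < s; s \<le> d1; 0 < t; t \<le> d1\<rbrakk> \<Longrightarrow> comparison_angle x (f s) (g t) < \<alpha>"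
    using angle_less_imp_comparison_angle_less[OF f g ne(1,2) \<alpha>] by metis
  obtain d2 where d2: "0 < d2" "d2 \<le> dist x z" "d2 \<le> dist x w"
    "\<And>s t. \<lbrakk>0 < s; s \<le> d2; 0 < t; t \<le> d2\<rbrakk> \<Longrightarrow> comparison_angle x (g s) (h t) < \<beta>"
    using angle_less_imp_comparison_angle_less[OF g h ne(2,3) \<beta>] by metis
  define s where "s = min d1 d2"
  have s: "0 < s" "s \<le> d1" "s \<le> d2" using d1 d2 by (auto simp: s_def)
  have sin: "sin \<alpha> > 0" "sin \<beta> > 0" "sin (\<alpha> + \<beta>) > 0" using pos lt by (auto intro: sin_gt_zero)
  \<comment> \<open>The chord from \<open>P = s e\<^sup>i\<^sup>\<alpha>\<close> to \<open>Q = s e\<^sup>-\<^sup>i\<^sup>\<beta>\<close> meets the real axis at \<open>t = k P + (1 - k) Q\<close>.\<close>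
  define k where "k = sin \<beta> / (sin \<alpha> + sin \<beta>)"
  define t where "t = s * sin (\<alpha> + \<beta>) / (sin \<alpha> + sin \<beta>)"
  have k: "0 \<le> k" "k \<le> 1" "1 - k = sin \<alpha> / (sin \<alpha> + sin \<beta>)"
    using sin by (auto simp: k_def field_simps)
  have "sin (\<alpha> + \<beta>) \<le> sin \<alpha> + sin \<beta>"
    unfolding sin_add using mult_left_le[of "cos \<beta>" "sin \<alpha>"] mult_right_le_one_le[of "sin \<beta>" "cos \<alpha>"] sin
    by (intro add_mono) (auto simp: mult_left_le mult.commute[of "cos \<alpha>"])
  then have "s * sin (\<alpha> + \<beta>) \<le> s * (sin \<alpha> + sin \<beta>)" using s by (intro mult_left_mono) auto
  then have t: "0 < t" "t \<le> s" using sin s by (auto simp: t_def pos_divide_le_eq)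
  define P Q :: complex where "P = s *\<^sub>R cis \<alpha>" and "Q = s *\<^sub>R cis (-\<beta>)"
  have T: "of_real t = k *\<^sub>R P + (1 - k) *\<^sub>R Q"
    unfolding k(3) unfolding k_def t_def P_def Q_def using sin
    by (simp add: complex_eq_iff sin_add divide_simps) (simp add: algebra_simps)
  have "dist P (of_real t) = (1 - k) * dist P Q"
  proof -
    have "P - of_real t = (1 - k) *\<^sub>R (P - Q)" unfolding T by (simp add: algebra_simps)
    then show ?thesis using k(1,2) by (simp add: dist_norm)
  qed
  moreover have "dist (of_real t) Q = k * dist P Q"
  proof -
    have "of_real t - Q = k *\<^sub>R (P - Q)" unfolding T by (simp add: algebra_simps)
    then show ?thesis using k(1,2) by (simp add: dist_norm)
  qed
  ultimately have split: "dist P Q = dist P (of_real t) + dist (of_real t) Q" by (simp add: algebra_simps)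
  have cosines: "(dist (a *\<^sub>R cis \<phi>) (b *\<^sub>R cis \<psi>))\<^sup>2 = a\<^sup>2 + b\<^sup>2 - 2 * a * b * cos (\<phi> - \<psi>)" for a b \<phi> \<psi>
  proof -
    have "(dist (a *\<^sub>R cis \<phi>) (b *\<^sub>R cis \<psi>))\<^sup>2
      = (a * cos \<phi> - b * cos \<psi>)\<^sup>2 + (a * sin \<phi> - b * sin \<psi>)\<^sup>2"
      by (simp add: dist_norm cmod_power2)
    also have "\<dots> = a\<^sup>2 * ((cos \<phi>)\<^sup>2 + (sin \<phi>)\<^sup>2) + b\<^sup>2 * ((cos \<psi>)\<^sup>2 + (sin \<psi>)\<^sup>2)
      - 2 * a * b * cos (\<phi> - \<psi>)"
      unfolding cos_diff by algebra
    finally show ?thesis by simp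
  qed
  have d: "dist x (f s) = s" "dist x (g t) = t" "dist x (h s) = s"
    using s t d1 d2 by (auto intro!: geodesic_segment_dist[OF f] geodesic_segment_dist[OF g] geodesic_segment_dist[OF h])
  have ne': "x \<noteq> f s" "x \<noteq> g t" "x \<noteq> h s" using d s t by auto
  have "comparison_angle x (f s) (g t) \<le> \<alpha>" using d1(4)[of s t] s t by auto
  then have "(dist (f s) (g t))\<^sup>2 \<le> (dist P (of_real t))\<^sup>2"
    using comparison_angle_le_iff[OF ne'(1,2), of \<alpha>] pos lt cosines[of s \<alpha> t 0]
    by (simp add: d P_def scaleR_conv_of_real)
  then have 1: "dist (f s) (g t) \<le> dist P (of_real t)" by (rule power2_le_imp_le) simp
  have "comparison_angle x (g t) (h s) \<le> \<beta>" using d2(4)[of t s] s t by auto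
  then have "(dist (g t) (h s))\<^sup>2 \<le> (dist (of_real t) Q)\<^sup>2"
    using comparison_angle_le_iff[OF ne'(2,3), of \<beta>] pos lt cosines[of t 0 s "-\<beta>"]
    by (simp add: d Q_def scaleR_conv_of_real)
  then have 2: "dist (g t) (h s) \<le> dist (of_real t) Q" by (rule power2_le_imp_le) simp
  have "dist (f s) (h s) \<le> dist P Q" using 1 2 split dist_triangle[of "f s" "h s" "g t"] by simp
  then have "(dist (f s) (h s))\<^sup>2 \<le> (dist P Q)\<^sup>2" by (intro power_mono) auto
  then have "comparison_angle x (f s) (h s) \<le> \<alpha> + \<beta>"
    using comparison_angle_le_iff[OF ne'(1,3), of "\<alpha> + \<beta>"] pos lt cosines[of s \<alpha> s "-\<beta>"]
    by (simp add: d P_def Q_def)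
  moreover have "angle f h \<le> comparison_angle x (f s) (h s)"
    using s d1 d2 by (intro angle_tendsto(2)[OF f h ne(1,3)]) auto
  ultimately show False using sum by simp
qed

lemma vertex_angle_le_comparison_angle:
  fixes x y z :: "'a::cat0_space"
  assumes "x \<noteq> y" "x \<noteq> z"
  shows "vertex_angle x y z \<le> comparison_angle x y z"
  using angle_tendsto(2)[OF geodesic_segment_segment_between geodesic_segment_segment_between assms,
      of "dist x y" "dist x z"] assms
    geodesic_segment_segment_between[of x y] geodesic_segment_segment_between[of x z]
  by (simp add: vertex_angle_def geodesic_segment_def)

lemma vertex_angle_bounds:
  fixes x y z :: "'a::cat0_space"
  assumes "x \<noteq> y" "x \<noteq> z"
  shows "0 \<le> vertex_angle x y z" "vertex_angle x y z \<le> pi"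
proof -
  show "0 \<le> vertex_angle x y z" unfolding vertex_angle_def
    by (rule angle_nonneg[OF geodesic_segment_segment_between geodesic_segment_segment_between assms])
  show "vertex_angle x y z \<le> pi"
    using vertex_angle_le_comparison_angle[OF assms] comparison_angle_bounds[OF assms] by simp
qed

lemma vertex_angle_triangle:
  fixes x y z w :: "'a::cat0_space"
  assumes "x \<noteq> y" "x \<noteq> z" "x \<noteq> w"
  shows "vertex_angle x y w \<le> vertex_angle x y z + vertex_angle x z w"
  unfolding vertex_angle_def 
  by (rule angle_triangle[OF geodesic_segment_segment_between geodesic_segment_segment_between
        geodesic_segment_segment_between assms])

lemma vertex_angle_same:
  fixes x y :: "'a::cat0_space"
  assumes "x \<noteq> y"
  shows "vertex_angle x y y = 0"
  using vertex_angle_le_comparison_angle[OF assms assms] vertex_angle_bounds[OF assms assms] assms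
  by (simp add: comparison_angle_def power2_eq_square)

lemma vertex_angle_commute:
  fixes x y z :: "'a::cat0_space"
  assumes "x \<noteq> y" "x \<noteq> z"
  shows "vertex_angle x y z = vertex_angle x z y"
proof -
  have *: "vertex_angle x y z \<le> vertex_angle x z y" if ne: "x \<noteq> y" "x \<noteq> z" for y z :: 'a
  proof (rule ccontr)
    assume "\<not> ?thesis"
    then have "angle (segment_between x z) (segment_between x y) < vertex_angle x y z"
      by (simp add: vertex_angle_def)
    then obtain d where d: "0 < d" "d \<le> dist x z" "d \<le> dist x y"
      "comparison_angle x (segment_between x z d) (segment_between x y d) < vertex_angle x y z"
      using angle_less_imp_comparison_angle_less[OF geodesic_segment_segment_between
        geodesic_segment_segment_between ne(2,1)] by (metis order_refl)
    moreover have "vertex_angle x y z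
        \<le> comparison_angle x (segment_between x y d) (segment_between x z d)"
      unfolding vertex_angle_def using d
      by (intro angle_tendsto(2)[OF geodesic_segment_segment_between
        geodesic_segment_segment_between ne]) auto
    ultimately show False by (simp add: comparison_angle_commute)
  qed
  show ?thesis using *[OF assms] *[OF assms(2,1)] by simp
qed

section \<open>Polygons seen from a point\<close>

text \<open>
  At \<open>y\<close> the angle of the polygon is at most the sum of the angles of its two edges with the segment
  to \<open>p\<close>; the angle at \<open>y\<close> towards \<open>x\<close> is estimated by the angle sum of the model triangle of \<open>p, x, y\<close>.
\<close>

lemma exterior_angle_step:
  fixes p x y z :: "'a::cat0_space"
  assumes "p \<noteq> x" "p \<noteq> y" "x \<noteq> y" "y \<noteq> z"
  shows "pi - vertex_angle y p z + comparison_angle p x y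
    \<le> (pi - vertex_angle x p y) + (pi - vertex_angle y x z)"
proof -
  have "vertex_angle y x z \<le> vertex_angle y x p + vertex_angle y p z"
    using assms by (intro vertex_angle_triangle) auto
  moreover have "vertex_angle y x p \<le> comparison_angle y x p" 
    using assms by (intro vertex_angle_le_comparison_angle) auto
  moreover have "vertex_angle x p y \<le> comparison_angle x p y" 
    using assms by (intro vertex_angle_le_comparison_angle) auto
  moreover have "comparison_angle p x y + comparison_angle x p y + comparison_angle y p x = pi"
    using assms by (intro comparison_angle_sum) auto
  ultimately show ?thesis using comparison_angle_commute[of y x p] by linarith
qed

text \<open>
  The same triangle inequality at \<open>y\<close>, but with the angle towards \<open>x\<close> estimated by the law of sines.
  The weights make the first summand carry over from vertex to vertex without loss, so that in a
  long polygon only the rotations accumulate.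
\<close>

lemma weighted_exterior_angle_step:
  fixes p x y z :: "'a::cat0_space"
  assumes "p \<noteq> x" "p \<noteq> y" "x \<noteq> y" "y \<noteq> z"
  shows "dist p y * (pi - vertex_angle y p z)
    \<le> dist p x * (pi - vertex_angle x p y) + dist p y * (pi - vertex_angle y x z)"
proof -
  have "vertex_angle y x z \<le> vertex_angle y x p + vertex_angle y p z"
    using assms by (intro vertex_angle_triangle) auto
  moreover have "vertex_angle y x p \<le> comparison_angle y p x" 
    unfolding comparison_angle_commute[of y p x]
    using assms by (intro vertex_angle_le_comparison_angle) auto
  ultimately have "pi - vertex_angle y p z \<le> comparison_angle y p x + (pi - vertex_angle y x z)"
    by linarith
  then have "dist p y * (pi - vertex_angle y p z)
      \<le> dist p y * comparison_angle y p x + dist p y * (pi - vertex_angle y x z)"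
    unfolding distrib_left[symmetric] by (rule mult_left_mono) simp
  moreover have "dist p y * comparison_angle y p x \<le> dist p x * (pi - comparison_angle x p y)"
    using assms by (intro mult_comparison_angle_le) auto
  moreover have "dist p x * (pi - comparison_angle x p y) \<le> dist p x * (pi - vertex_angle x p y)"
    using vertex_angle_le_comparison_angle[of x p y] assms by (intro mult_left_mono) auto
  ultimately show ?thesis by linarith
qed

lemma comparison_angle_le_exterior_angle:
  fixes p x y :: "'a::cat0_space"
  assumes "p \<noteq> x" "p \<noteq> y" "x \<noteq> y"
  shows "comparison_angle p x y \<le> pi - vertex_angle x p y"
proof -
  have "vertex_angle x p y \<le> comparison_angle x p y" "0 \<le> comparison_angle y p x"
    using assms by (auto intro: vertex_angle_le_comparison_angle comparison_angle_bounds)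
  moreover have "comparison_angle p x y + comparison_angle x p y + comparison_angle y p x = pi"
    using assms by (intro comparison_angle_sum) auto
  ultimately show ?thesis by linarith
qed

text \<open>
  The true angle at \<open>x\<close> is at most that of the model triangle, so putting it into the law of cosines
  gives a lower bound for \<open>d(p, y)\<^sup>2\<close>, and
  \<open>r\<^sup>2 + l\<^sup>2 + 2 r l cos u \<ge> (r + l cos u)\<^sup>2\<close>.
\<close>

lemma dist_step_ge:
  fixes p x y :: "'a::cat0_space"
  assumes "p \<noteq> x" "x \<noteq> y"
  shows "dist p x + dist x y * cos (pi - vertex_angle x p y) \<le> dist p y"
proof (rule power2_le_imp_le)
  let ?c = "cos (vertex_angle x p y)"
  have "cos (comparison_angle x p y) \<le> ?c"
    using assms vertex_angle_bounds[of x p y] vertex_angle_le_comparison_angle[of x p y]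
      comparison_angle_bounds[of x p y] by (intro cos_monotone_0_pi_le) auto
  then have "2 * dist x p * dist x y * cos (comparison_angle x p y) \<le> 2 * dist x p * dist x y * ?c"
    by (intro mult_left_mono) auto
  then have "(dist x p)\<^sup>2 + (dist x y)\<^sup>2 - 2 * dist x p * dist x y * ?c \<le> (dist p y)\<^sup>2"
    using law_of_cosines[of x p y] assms by simp
  moreover have "(dist x y)\<^sup>2 * ?c\<^sup>2 \<le> (dist x y)\<^sup>2"
    by (intro mult_left_le) (auto simp: abs_square_le_1)
  ultimately show "(dist p x + dist x y * cos (pi - vertex_angle x p y))\<^sup>2 \<le> (dist p y)\<^sup>2"
    by (simp add: power2_eq_square algebra_simps dist_commute)
qed simp

section \<open>Total rotation under refinement and concatenation\<close>

lemma total_rotation_simps [simp]: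
  "total_rotation [] = 0" "total_rotation [x] = 0" "total_rotation [x, y] = 0"
  "total_rotation (x # y # z # zs) = (pi - vertex_angle y x z) + total_rotation (y # z # zs)"
proof -
  have *: "length (x # y # z # zs) - 2 = Suc (length (y # z # zs) - 2)" by simp
  show "total_rotation (x # y # z # zs) = (pi - vertex_angle y x z) + total_rotation (y # z # zs)"
    unfolding total_rotation_def * sum.lessThan_Suc_shift by simp
qed (simp_all add: total_rotation_def)

text \<open>
  A polygon can be cut along an edge without loss: both pieces keep the edge, so each interior
  vertex keeps its two neighbours in exactly one piece.
\<close>

lemma total_rotation_split_edge:
  "total_rotation (xs @ a # b # ys) = total_rotation (xs @ [a, b]) + total_rotation (a # b # ys)"
proof (induction xs)
  case (Cons x xs)
  show ?case
  proof (cases xs)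
    case (Cons y xs')
    then show ?thesis using Cons.IH by (cases xs') auto
  qed simp
qed simp

lemma total_rotation_nonneg:
  fixes vs :: "'a::cat0_space list"
  assumes "distinct_adj vs"
  shows "0 \<le> total_rotation vs"
  using assms
proof (induction vs rule: induct_list012)
  case (3 x y zs)
  then show ?case using vertex_angle_bounds(2)[of y x "hd zs"] by (cases zs) auto
qed auto

text \<open>
  Joining two polygons at an end point only adds the exterior angle there.
\<close>

lemma total_rotation_concat:
  fixes xs ys :: "'a::cat0_space list"
  assumes "distinct_adj (xs @ a # ys)"
  shows "total_rotation (xs @ [a]) + total_rotation (a # ys) \<le> total_rotation (xs @ a # ys)"
proof (cases xs rule: rev_cases)
  case (snoc xs' x)
  show ?thesis
  proof (cases ys)
    case (Cons y ys')
    have "vertex_angle a x y \<le> pi"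
      using assms unfolding snoc Cons by (intro vertex_angle_bounds) (auto simp: distinct_adj_append_iff)
    then show ?thesis
      using total_rotation_split_edge[of xs' x a "y # ys'"] by (simp add: snoc Cons)
  qed simp
qed simp

text \<open>
  Inserting \<open>w\<close> between \<open>x\<close> and \<open>y\<close> costs at most the angles at \<open>x\<close> and \<open>y\<close> of the triangle
  \<open>x w y\<close>; the new exterior angle at \<open>w\<close> pays for them because the angle sum is at most \<open>\<pi>\<close>.
\<close>

lemma total_rotation_insert:
  fixes xs ys :: "'a::cat0_space list"
  assumes adj: "distinct_adj (xs @ x # w # y # ys)" and xy: "x \<noteq> y"
  shows "total_rotation (xs @ x # y # ys) \<le> total_rotation (xs @ x # w # y # ys)"
proof -
  have ne: "x \<noteq> w" "w \<noteq> y" using adj by (auto simp: distinct_adj_append_iff)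
  have "vertex_angle w x y \<le> comparison_angle w x y" "vertex_angle x w y \<le> comparison_angle x w y"
    "vertex_angle y x w \<le> comparison_angle y x w"
    using ne xy by (auto intro!: vertex_angle_le_comparison_angle)
  moreover have "comparison_angle w x y + comparison_angle x w y + comparison_angle y w x = pi"
    using ne xy by (intro comparison_angle_sum) auto
  ultimately have sum: "vertex_angle w x y + vertex_angle x w y + vertex_angle y x w \<le> pi"
    using comparison_angle_commute[of y x w] by linarith
  have left: "total_rotation (xs @ [x, y]) \<le> total_rotation (xs @ [x, w]) + vertex_angle x w y"
  proof (cases xs rule: rev_cases)
    case Nil
    then show ?thesis using vertex_angle_bounds[of x w y] ne xy by simp
  next
    case (snoc xs' v)
    have "vertex_angle x v w \<le> vertex_angle x v y + vertex_angle x y w"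
      using adj xy ne unfolding snoc by (intro vertex_angle_triangle) (auto simp: distinct_adj_append_iff)
    moreover have "vertex_angle x y w = vertex_angle x w y"
      using ne xy by (intro vertex_angle_commute) auto
    ultimately show ?thesis
      using total_rotation_split_edge[of xs' v x "[y]"] total_rotation_split_edge[of xs' v x "[w]"]
      by (simp add: snoc)
  qed
  have right: "total_rotation (x # y # ys) \<le> total_rotation (w # y # ys) + vertex_angle y x w"
  proof (cases ys)
    case Nil
    then show ?thesis using vertex_angle_bounds[of y x w] ne xy by simp
  next
    case (Cons z zs)
    have "vertex_angle y w z \<le> vertex_angle y w x + vertex_angle y x z"
      using adj xy ne unfolding Cons by (intro vertex_angle_triangle) (auto simp: distinct_adj_append_iff)
    moreover have "vertex_angle y w x = vertex_angle y x w"
      using ne xy by (intro vertex_angle_commute) auto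
    ultimately show ?thesis by (simp add: Cons)
  qed
  show ?thesis
    using left right sum total_rotation_split_edge[of xs x y ys]
      total_rotation_split_edge[of xs x w "y # ys"] by simp
qed

text \<open>
  The edges of \<open>xs @ [s]\<close> are already shorter than \<open>\<mu>\<close>.  If the next edge is too long, a vertex \<open>w\<close> with
  \<open>d(\<gamma> s, \<gamma> w) = \<mu> / 2\<close> is inserted; such a \<open>w\<close> differs from both neighbours, so no degenerate edge
  arises even if the curve meets itself.  As the curve is 1-Lipschitz, \<open>w\<close> is at least \<open>\<mu> / 2\<close> later
  than \<open>s\<close>.  Hence every step, whether it inserts a vertex or passes on to the next one, lowers the
  remaining time in units of \<open>\<mu> / 2\<close> plus the number of remaining vertices by at least one.
\<close>

lemma exists_fine_refinement:
  fixes \<gamma> :: "real \<Rightarrow> 'a::cat0_space" and n :: nat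
  assumes lip: "\<And>s t. 0 \<le> s \<Longrightarrow> s \<le> t \<Longrightarrow> dist (\<gamma> s) (\<gamma> t) \<le> t - s" and \<mu>: "\<mu> > 0"
  assumes "sorted_wrt (<) (xs @ s # ts)" "\<forall>u\<in>set (xs @ s # ts). 0 \<le> u"
    "distinct_adj (map \<gamma> (xs @ s # ts))"
    "successively (\<lambda>u v. dist (\<gamma> u) (\<gamma> v) < \<mu>) (xs @ [s])"
    "(last (s # ts) - s) / (\<mu> / 2) + length ts \<le> n"
  shows "\<exists>us. us \<noteq> [] \<and> sorted_wrt (<) us \<and> hd us = hd (xs @ [s]) \<and> last us = last (s # ts)
    \<and> distinct_adj (map \<gamma> us) \<and> successively (\<lambda>u v. dist (\<gamma> u) (\<gamma> v) < \<mu>) us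
    \<and> total_rotation (map \<gamma> (xs @ s # ts)) \<le> total_rotation (map \<gamma> us)"
  using assms(3-)
proof (induction n arbitrary: xs s ts)
  case 0
  show ?case
  proof (cases ts)
    case Nil
    then show ?thesis using 0 by (intro exI[of _ "xs @ [s]"]) auto
  next
    case (Cons y zs)
    have "last (s # ts) \<in> set ts" using Cons by simp
    then have "s < last (s # ts)" using 0(1) by (auto simp: sorted_wrt_append)
    then have "(last (s # ts) - s) / (\<mu> / 2) + length ts > 0" using \<mu> by (intro add_pos_nonneg) auto
    then show ?thesis using 0(5) by simp
  qed
next
  case (Suc n)
  show ?case
  proof (cases ts)
    case Nil
    then show ?thesis using Suc by (intro exI[of _ "xs @ [s]"]) auto
  next
    case (Cons y zs)
    note prems = Suc.prems[unfolded Cons]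
    have sy: "s < y" "0 \<le> s" using prems by (auto simp: sorted_wrt_append)
    have hd: "hd ((xs @ [s]) @ [a]) = hd (xs @ [s])" for a by (cases xs) auto
    show ?thesis
    proof (cases "dist (\<gamma> s) (\<gamma> y) < \<mu>")
      case True
      have "(last (y # zs) - y) / (\<mu> / 2) \<le> (last (y # zs) - s) / (\<mu> / 2)"
        using sy \<mu> by (intro divide_right_mono) auto
      then have len: "(last (y # zs) - y) / (\<mu> / 2) + length zs \<le> n" using prems(5) by simp
      have step: "successively (\<lambda>u v. dist (\<gamma> u) (\<gamma> v) < \<mu>) ((xs @ [s]) @ [y])"
        using prems(4) True by (simp add: successively_append_iff)
      show ?thesis
        using Suc.IH[of "xs @ [s]" y zs] prems len step unfolding hd Cons by simp
    next
      case False
      have "continuous_on {s..y} (\<lambda>u. dist (\<gamma> s) (\<gamma> u))"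
      proof (rule continuous_on_dist[OF continuous_on_const])
        have "1-lipschitz_on {s..y} \<gamma>"
        proof (rule lipschitz_onI)
          fix u v assume "u \<in> {s..y}" "v \<in> {s..y}"
          then show "dist (\<gamma> u) (\<gamma> v) \<le> 1 * dist u v"
            using lip[of u v] lip[of v u] sy by (cases "u \<le> v") (auto simp: dist_commute dist_real_def)
        qed simp
        then show "continuous_on {s..y} \<gamma>" by (rule lipschitz_on_continuous_on)
      qed
      then obtain w where w: "s \<le> w" "w \<le> y" "dist (\<gamma> s) (\<gamma> w) = \<mu> / 2"
        using IVT'[of "\<lambda>u. dist (\<gamma> s) (\<gamma> u)" s "\<mu> / 2" y] False \<mu> sy by auto
      have ne: "\<gamma> s \<noteq> \<gamma> w" "\<gamma> w \<noteq> \<gamma> y" "s \<noteq> w" "w \<noteq> y" using w False \<mu> by auto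
      then have sw: "s < w" "w < y" using w by auto
      have ws: "\<mu> / 2 \<le> w - s" using lip[of s w] w sy by simp
      let ?xs = "xs @ [s]"
      have sorted: "sorted_wrt (<) (?xs @ w # y # zs)"
        using prems(1) sw by (fastforce simp: sorted_wrt_append)
      have nonneg: "\<forall>u\<in>set (?xs @ w # y # zs). 0 \<le> u" using prems(2) w sy by auto
      have adj: "distinct_adj (map \<gamma> (?xs @ w # y # zs))"
        using prems(3) ne by (auto simp: distinct_adj_append_iff)
      have fine: "successively (\<lambda>u v. dist (\<gamma> u) (\<gamma> v) < \<mu>) (?xs @ [w])"
        using prems(4) w \<mu> by (simp add: successively_append_iff)
      have "(last (w # y # zs) - w) / (\<mu> / 2) + 1 \<le> (last (y # zs) - s) / (\<mu> / 2)"
      proof -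
        have "1 \<le> (w - s) / (\<mu> / 2)" using ws \<mu> by (subst pos_le_divide_eq) auto
        moreover have "(last (y # zs) - s) / (\<mu> / 2) = (last (y # zs) - w) / (\<mu> / 2) + (w - s) / (\<mu> / 2)"
          unfolding add_divide_distrib[symmetric] by simp
        ultimately show ?thesis by simp
      qed
      then have len: "(last (w # y # zs) - w) / (\<mu> / 2) + length (y # zs) \<le> n"
        using prems(5) by simp
      have "total_rotation (map \<gamma> (xs @ s # y # zs)) \<le> total_rotation (map \<gamma> (?xs @ w # y # zs))"
        using total_rotation_insert[of "map \<gamma> xs" "\<gamma> s" "\<gamma> w" "\<gamma> y" "map \<gamma> zs"] adj prems(3)
        by (simp add: distinct_adj_append_iff)
      then show ?thesis
        using Suc.IH[OF sorted nonneg adj fine len] unfolding hd Cons by fastforce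
    qed
  qed
qed

lemma finite_segment_lengths: "finite {dist (vs ! i) (vs ! (i+1)) |i. i + 1 < length vs}"
  by (rule finite_subset[of _ "(\<lambda>i. dist (vs ! i) (vs ! (i+1))) ` {..<length vs}"]) auto

lemma max_segment_length_nonneg: "0 \<le> max_segment_length vs"
  unfolding max_segment_length_def using finite_segment_lengths by (intro Max_ge) auto

lemma max_segment_length_less:
  assumes "successively (\<lambda>u v. dist (\<gamma> u) (\<gamma> v) < \<mu>) us" "\<mu> > 0"
  shows "max_segment_length (map \<gamma> us) < \<mu>"
proof -
  have "dist (map \<gamma> us ! i) (map \<gamma> us ! (i + 1)) < \<mu>" if "i + 1 < length us" for i
    using assms(1) that by (auto simp: successively_conv_nth)
  then show ?thesis
    unfolding max_segment_length_def using assms(2) finite_segment_lengths[of "map \<gamma> us"]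
    by (subst Max_less_iff) auto
qed

text \<open>
  Whatever mesh the limit requires, a refinement of \<open>vs\<close> has it, and its total rotation is at least
  that of \<open>vs\<close>.
\<close>

lemma total_rotation_le_total_curvature:
  fixes \<gamma> :: "real \<Rightarrow> 'a::cat0_space"
  assumes lip: "\<And>s t. 0 \<le> s \<Longrightarrow> s \<le> t \<Longrightarrow> dist (\<gamma> s) (\<gamma> t) \<le> t - s"
    and a: "0 \<le> a" and vs: "vs \<in> inscribed_polygons \<gamma> a b"
  shows "ereal (total_rotation vs) \<le> total_curvature \<gamma> a b"
  unfolding total_curvature_def Limsup_def
proof (rule INF_greatest)
  fix P assume "P \<in> {P. eventually P (inf (filtercomap max_segment_length (nhds 0))
    (principal (inscribed_polygons \<gamma> a b)))}"
  then obtain Q where Q: "eventually Q (nhds (0::real))"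
    "\<And>us. Q (max_segment_length us) \<Longrightarrow> us \<in> inscribed_polygons \<gamma> a b \<Longrightarrow> P us"
    by (auto simp: eventually_inf_principal eventually_filtercomap)
  then obtain \<mu> where \<mu>: "\<mu> > 0" "\<And>r. \<bar>r\<bar> < \<mu> \<Longrightarrow> Q r"
    by (auto simp: eventually_nhds_metric)
  obtain ts where ts: "ts \<noteq> []" "sorted_wrt (<) ts" "hd ts = a" "last ts = b"
    "distinct_adj (map \<gamma> ts)" "vs = map \<gamma> ts"
    using vs by (auto simp: inscribed_polygons_def partitions_def)
  obtain s ts' where ts': "ts = s # ts'" using ts(1) by (cases ts) auto
  obtain n :: nat where n: "(last ts - s) / (\<mu> / 2) + length ts' \<le> n" using real_arch_simple by blast
  have "\<forall>u\<in>set ts. 0 \<le> u" using ts a unfolding ts' by auto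
  then obtain us where us: "us \<noteq> []" "sorted_wrt (<) us" "hd us = a" "last us = b"
    "distinct_adj (map \<gamma> us)" "successively (\<lambda>u v. dist (\<gamma> u) (\<gamma> v) < \<mu>) us"
    "total_rotation vs \<le> total_rotation (map \<gamma> us)"
    using exists_fine_refinement[OF lip \<mu>(1), of "[]" s ts' n] ts n unfolding ts' by auto
  then have "map \<gamma> us \<in> inscribed_polygons \<gamma> a b"
    by (auto simp: inscribed_polygons_def partitions_def)
  then have "P (map \<gamma> us)"
    using \<mu> us max_segment_length_less[OF us(6) \<mu>(1)] max_segment_length_nonneg[of "map \<gamma> us"]
    by (intro Q(2)) auto
  then show "ereal (total_rotation vs) \<le> (SUP us\<in>Collect P. ereal (total_rotation us))"
    using us(7) by (intro SUP_upper2[of "map \<gamma> us"]) auto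
qed

lemma inscribed_polygons_concat:
  fixes \<gamma> :: "real \<Rightarrow> 'a::cat0_space"
  assumes "vs \<in> inscribed_polygons \<gamma> a b" "ws \<in> inscribed_polygons \<gamma> b c"
  shows "\<exists>us\<in>inscribed_polygons \<gamma> a c. total_rotation vs + total_rotation ws \<le> total_rotation us"
proof -
  obtain ts where ts: "ts \<noteq> []" "sorted_wrt (<) ts" "hd ts = a" "last ts = b"
    "distinct_adj (map \<gamma> ts)" "vs = map \<gamma> ts"
    using assms(1) by (auto simp: inscribed_polygons_def partitions_def)
  obtain ss where ss: "ss \<noteq> []" "sorted_wrt (<) ss" "hd ss = b" "last ss = c"
    "distinct_adj (map \<gamma> ss)" "ws = map \<gamma> ss"
    using assms(2) by (auto simp: inscribed_polygons_def partitions_def)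
  obtain ts' where ts': "ts = ts' @ [b]" using ts(1,4) by (metis append_butlast_last_id)
  obtain ss' where ss': "ss = b # ss'" using ss(1,3) by (metis list.collapse)
  have adj: "distinct_adj (map \<gamma> ts' @ \<gamma> b # map \<gamma> ss')"
    using ts(5) ss(5) unfolding ts' ss'
    by (cases ts' rule: rev_cases; cases ss') (auto simp: distinct_adj_append_iff)
  have "sorted_wrt (<) (ts' @ b # ss')"
    using ts(2) ss(2) unfolding ts' ss' by (fastforce simp: sorted_wrt_append)
  moreover have "hd (ts' @ b # ss') = a" using ts(3) unfolding ts' by (cases ts') auto
  moreover have "last (ts' @ b # ss') = c" using ss(4) unfolding ss' by simp
  ultimately have "map \<gamma> (ts' @ b # ss') \<in> inscribed_polygons \<gamma> a c"
    unfolding inscribed_polygons_def partitions_def using adj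
    by (intro CollectI exI[of _ "ts' @ b # ss'"]) auto
  moreover have "total_rotation vs + total_rotation ws \<le> total_rotation (map \<gamma> (ts' @ b # ss'))"
    using total_rotation_concat[OF adj] by (simp add: ts(6) ss(6) ts' ss')
  ultimately show ?thesis by blast
qed

section \<open>Curves parametrized by arclength\<close>

lemma partitions_bounds:
  assumes "ts \<in> partitions a b" "u \<in> set ts"
  shows "a \<le> u" "u \<le> b"
proof -
  obtain xs where "ts = a # xs" using assms by (cases ts) (auto simp: partitions_def)
  then show "a \<le> u" using assms by (auto simp: partitions_def)
  obtain ys where "ts = ys @ [b]" using assms by (cases ts rule: rev_cases) (auto simp: partitions_def)
  then show "u \<le> b" using assms by (auto simp: partitions_def sorted_wrt_append)
qed

lemma arclength_dist_le:
  assumes "arclength_parametrized \<gamma>" "0 \<le> s" "s \<le> t"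
  shows "dist (\<gamma> s) (\<gamma> t) \<le> t - s"
proof (cases "s = t")
  case False
  then have "[s, t] \<in> partitions s t" using assms by (auto simp: partitions_def)
  then have "ereal (\<Sum>i<length [s, t] - 1. dist (\<gamma> ([s, t] ! i)) (\<gamma> ([s, t] ! (i+1)))) \<le> curve_length \<gamma> s t"
    unfolding curve_length_def by (rule SUP_upper)
  then show ?thesis using assms by (simp add: arclength_parametrized_def)
qed simp

text \<open>
  A curve that is constant on an interval has length zero there.
\<close>

lemma arclength_exists_other_point:
  assumes "arclength_parametrized \<gamma>" "0 \<le> s" "s < t"
  shows "\<exists>w\<in>{s<..t}. \<gamma> w \<noteq> \<gamma> s"
proof (rule ccontr)
  assume "\<not> ?thesis"
  then have const: "\<gamma> w = \<gamma> s" if "s \<le> w" "w \<le> t" for w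
    using that by (cases "w = s") auto
  have "curve_length \<gamma> s t \<le> 0"
    unfolding curve_length_def
  proof (rule SUP_least)
    fix ts assume ts: "ts \<in> partitions s t"
    have "dist (\<gamma> (ts ! i)) (\<gamma> (ts ! (i+1))) = 0" if "i < length ts - 1" for i
      using const[of "ts ! i"] const[of "ts ! (i+1)"] partitions_bounds[OF ts] that by simp
    then show "ereal (\<Sum>i<length ts - 1. dist (\<gamma> (ts ! i)) (\<gamma> (ts ! (i+1)))) \<le> 0"
      by simp
  qed
  then show False using assms by (simp add: arclength_parametrized_def)
qed

lemma inscribed_polygons_nonempty:
  assumes "arclength_parametrized \<gamma>" "0 \<le> s" "s \<le> t"
  shows "inscribed_polygons \<gamma> s t \<noteq> {}"
proof -
  obtain w where w: "s \<le> w" "w \<le> t" "s < t \<longrightarrow> \<gamma> w \<noteq> \<gamma> s \<and> s < w"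
  proof (cases "s < t")
    case True
    then obtain w where "w \<in> {s<..t}" "\<gamma> w \<noteq> \<gamma> s"
      using arclength_exists_other_point[OF assms(1,2)] by blast
    then show ?thesis using that[of w] by auto
  qed (use that[of s] assms(3) in auto)
  consider "s = t" | "s < t" "\<gamma> s \<noteq> \<gamma> t" | "s < w" "w < t" "\<gamma> s \<noteq> \<gamma> w" "\<gamma> w \<noteq> \<gamma> t"
    using w assms(3) by (metis order_le_less)
  then have "\<exists>ts\<in>partitions s t. distinct_adj (map \<gamma> ts)"
  proof cases
    case 1
    then show ?thesis by (intro bexI[of _ "[s]"]) (auto simp: partitions_def)
  next
    case 2
    then show ?thesis by (intro bexI[of _ "[s, t]"]) (auto simp: partitions_def)
  next
    case 3
    then show ?thesis by (intro bexI[of _ "[s, w, t]"]) (auto simp: partitions_def)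
  qed
  then show ?thesis by (auto simp: inscribed_polygons_def)
qed

lemma total_rotation_inscribed_nonneg:
  fixes \<gamma> :: "real \<Rightarrow> 'a::cat0_space"
  assumes "vs \<in> inscribed_polygons \<gamma> s t"
  shows "0 \<le> total_rotation vs"
  using assms by (auto simp: inscribed_polygons_def intro: total_rotation_nonneg)

lemma total_curvature_bounded:
  assumes "\<And>vs. vs \<in> inscribed_polygons \<gamma> s t \<Longrightarrow> ereal (total_rotation vs) \<le> C"
  shows "total_curvature \<gamma> s t \<le> C"
  unfolding total_curvature_def
  by (rule Limsup_bounded) (auto simp: eventually_inf_principal assms)

lemma total_curvature_nonneg:
  fixes \<gamma> :: "real \<Rightarrow> 'a::cat0_space"
  assumes "arclength_parametrized \<gamma>" "0 \<le> s" "s \<le> t"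
  shows "0 \<le> total_curvature \<gamma> s t"
proof -
  obtain vs where vs: "vs \<in> inscribed_polygons \<gamma> s t" using inscribed_polygons_nonempty[OF assms] by auto
  have "0 \<le> ereal (total_rotation vs)" using total_rotation_inscribed_nonneg[OF vs] by simp
  also have "\<dots> \<le> total_curvature \<gamma> s t"
    using assms(2) vs by (intro total_rotation_le_total_curvature arclength_dist_le[OF assms(1)])
  finally show ?thesis .
qed

lemma total_rotation_add_le_total_curvature:
  fixes \<gamma> :: "real \<Rightarrow> 'a::cat0_space"
  assumes "arclength_parametrized \<gamma>" "0 \<le> a"
    and "vs \<in> inscribed_polygons \<gamma> a s" "ws \<in> inscribed_polygons \<gamma> s t"
  shows "ereal (total_rotation vs + total_rotation ws) \<le> total_curvature \<gamma> a t"
proof -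
  obtain us where us: "us \<in> inscribed_polygons \<gamma> a t"
    "total_rotation vs + total_rotation ws \<le> total_rotation us"
    using inscribed_polygons_concat[OF assms(3,4)] by auto
  have "ereal (total_rotation vs + total_rotation ws) \<le> ereal (total_rotation us)" using us by simp
  also have "\<dots> \<le> total_curvature \<gamma> a t"
    using assms(2) us by (intro total_rotation_le_total_curvature arclength_dist_le[OF assms(1)])
  finally show ?thesis .
qed

lemma total_curvature_mono:
  fixes \<gamma> :: "real \<Rightarrow> 'a::cat0_space"
  assumes arc: "arclength_parametrized \<gamma>" and s: "0 \<le> s" "s \<le> t"
  shows "total_curvature \<gamma> 0 s \<le> total_curvature \<gamma> 0 t"
proof (rule total_curvature_bounded)
  fix vs assume vs: "vs \<in> inscribed_polygons \<gamma> 0 s"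
  obtain ws where ws: "ws \<in> inscribed_polygons \<gamma> s t" using inscribed_polygons_nonempty[OF assms] by auto
  have "ereal (total_rotation vs) \<le> ereal (total_rotation vs + total_rotation ws)"
    using total_rotation_inscribed_nonneg[OF ws] by simp
  also have "\<dots> \<le> total_curvature \<gamma> 0 t"
    by (rule total_rotation_add_le_total_curvature[OF arc order_refl vs ws])
  finally show "ereal (total_rotation vs) \<le> total_curvature \<gamma> 0 t" .
qed

lemma total_curvature_le_limit:
  fixes \<gamma> :: "real \<Rightarrow> 'a::cat0_space"
  assumes arc: "arclength_parametrized \<gamma>"
    and lim: "((\<lambda>t. total_curvature \<gamma> 0 t) \<longlongrightarrow> ereal \<tau>) at_top" and s: "0 \<le> s"
  shows "total_curvature \<gamma> 0 s \<le> ereal \<tau>"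
proof (rule tendsto_lowerbound[OF lim])
  show "eventually (\<lambda>t. total_curvature \<gamma> 0 s \<le> total_curvature \<gamma> 0 t) at_top"
    using eventually_ge_at_top[of s] by eventually_elim (rule total_curvature_mono[OF arc s])
qed simp

text \<open>
  Every polygon inscribed in \<open>\<gamma>\<close> up to time \<open>s\<close> can be joined with \<open>ws\<close>, and the result is inscribed in
  \<open>\<gamma>\<close> up to time \<open>t\<close>.
\<close>

lemma total_rotation_le_remaining_curvature:
  fixes \<gamma> :: "real \<Rightarrow> 'a::cat0_space"
  assumes arc: "arclength_parametrized \<gamma>"
    and lim: "((\<lambda>t. total_curvature \<gamma> 0 t) \<longlongrightarrow> ereal \<tau>) at_top"
    and s: "0 \<le> s" and ws: "ws \<in> inscribed_polygons \<gamma> s t"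
  shows "total_rotation ws \<le> \<tau> - real_of_ereal (total_curvature \<gamma> 0 s)"
proof -
  have "s \<le> t" using ws partitions_bounds
    by (fastforce simp: inscribed_polygons_def partitions_def)
  have "total_curvature \<gamma> 0 s \<le> ereal (\<tau> - total_rotation ws)"
  proof (rule total_curvature_bounded)
    fix vs assume "vs \<in> inscribed_polygons \<gamma> 0 s"
    then have "ereal (total_rotation vs + total_rotation ws) \<le> total_curvature \<gamma> 0 t"
      using ws by (intro total_rotation_add_le_total_curvature[OF arc]) auto
    also have "\<dots> \<le> ereal \<tau>"
      using s \<open>s \<le> t\<close> by (intro total_curvature_le_limit[OF arc lim]) auto
    finally show "ereal (total_rotation vs) \<le> ereal (\<tau> - total_rotation ws)" by simp
  qed
  moreover have "0 \<le> total_curvature \<gamma> 0 s" using s by (intro total_curvature_nonneg[OF arc]) auto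
  ultimately show ?thesis by (cases "total_curvature \<gamma> 0 s") auto
qed

section \<open>Curves whose tails turn little\<close>

text \<open>
  The bound \<open>K\<close> is a parameter because the function \<open>\<tau>\<^sub>\<gamma> - \<tau>\<close> enters the following geometry only through
  the total rotations of inscribed polygons.
\<close>

locale curve_with_small_tail_rotation =
  fixes \<gamma> :: "real \<Rightarrow> 'a::cat0_space" and K :: "real \<Rightarrow> real"
  assumes arclength: "arclength_parametrized \<gamma>"
    and total_rotation_le: "\<lbrakk>0 < s; vs \<in> inscribed_polygons \<gamma> s t\<rbrakk> \<Longrightarrow> total_rotation vs \<le> K s"
    and K_tendsto: "(K \<longlongrightarrow> 0) at_top"
begin

lemmas dist_le = arclength_dist_le[OF arclength]

lemma K_nonneg: "0 < s \<Longrightarrow> 0 \<le> K s"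
  using total_rotation_le[of s "[\<gamma> s]" s] by (force simp: inscribed_polygons_def partitions_def)

text \<open>
  The bound for polygons given by an increasing sequence of times, in the shape in which rotations
  are summed below: tails of one polygon are bounded by \<open>K\<close> at the time where they start.
\<close>

lemma rotation_sum_le:
  fixes \<theta> :: "nat \<Rightarrow> real"
  assumes "0 < \<theta> k" "k \<le> m" and mono: "\<And>i j. \<lbrakk>k \<le> i; i < j; j \<le> m\<rbrakk> \<Longrightarrow> \<theta> i < \<theta> j"
    and ne: "\<And>i. \<lbrakk>k \<le> i; i < m\<rbrakk> \<Longrightarrow> \<gamma> (\<theta> i) \<noteq> \<gamma> (\<theta> (Suc i))"
  shows "(\<Sum>j=k..<m-1. pi - vertex_angle (\<gamma> (\<theta> (j+1))) (\<gamma> (\<theta> j)) (\<gamma> (\<theta> (j+2)))) \<le> K (\<theta> k)"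
proof -
  let ?ts = "map \<theta> [k..<Suc m]"
  have "sorted_wrt (<) ?ts"
    by (auto simp: sorted_wrt_iff_nth_less intro!: mono simp del: upt_Suc)
  moreover have "hd ?ts = \<theta> k" "last ?ts = \<theta> m" using assms(2) by (simp_all add: hd_map del: upt_Suc) auto
  ultimately have "?ts \<in> partitions (\<theta> k) (\<theta> m)"
    using assms(2) by (auto simp: partitions_def simp del: upt_Suc)
  moreover have "distinct_adj (map \<gamma> ?ts)"
    unfolding distinct_adj_conv_nth using ne by (auto simp del: upt_Suc)
  ultimately have "total_rotation (map \<gamma> ?ts) \<le> K (\<theta> k)"
    using assms(1) by (intro total_rotation_le[of _ _ "\<theta> m"]) (unfold inscribed_polygons_def, blast+)
  moreover have "total_rotation (map \<gamma> ?ts)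
      = (\<Sum>i<m - 1 - k. pi - vertex_angle (\<gamma> (\<theta> (k+i+1))) (\<gamma> (\<theta> (k+i))) (\<gamma> (\<theta> (k+i+2))))"
    unfolding total_rotation_def by (rule sum.cong) (auto simp del: upt_Suc)
  moreover have "\<dots> = (\<Sum>j=k..<m-1. pi - vertex_angle (\<gamma> (\<theta> (j+1))) (\<gamma> (\<theta> j)) (\<gamma> (\<theta> (j+2))))"
    by (rule sum.reindex_bij_witness[of _ "\<lambda>j. j - k" "\<lambda>i. k + i"]) auto
  ultimately show ?thesis by simp
qed

text \<open>
  If the curve returned to \<open>\<gamma> s\<close>, then going to some other point and back would be an inscribed
  polygon with a vertex of angle zero, hence of total rotation \<open>\<pi>\<close>.
\<close>

lemma tail_injective:
  assumes "0 < s" "s < t" "K s < pi"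
  shows "\<gamma> s \<noteq> \<gamma> t"
proof
  assume eq: "\<gamma> s = \<gamma> t"
  obtain w where w: "s < w" "w \<le> t" "\<gamma> w \<noteq> \<gamma> s"
    using arclength_exists_other_point[OF arclength, of s t] assms by auto
  then have "w < t" using eq by (cases "w = t") auto
  then have "[\<gamma> s, \<gamma> w, \<gamma> t] \<in> inscribed_polygons \<gamma> s t"
    unfolding inscribed_polygons_def using w eq
    by (intro CollectI exI[of _ "[s, w, t]"]) (auto simp: partitions_def)
  from total_rotation_le[OF assms(1) this] show False
    using vertex_angle_same[OF w(3)] assms(3) eq by simp
qed

lemma eventually_K_less: "0 < e \<Longrightarrow> eventually (\<lambda>s. K s < e) at_top"
  using K_tendsto by (rule order_tendstoD)

text \<open>
  For a polygon inscribed between the times \<open>s\<close> and \<open>t\<close> and seen from its own first vertex, the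
  deviation from the radial direction starts at the rotation of the second vertex and grows by at
  most the rotations of the further vertices.  It thus stays below \<open>K s\<close>, and each edge of length
  \<open>l\<close> adds at least \<open>l cos (K s)\<close> to the distance.
\<close>

lemma chord_ge_length:
  assumes s: "0 < s" "s < t" and small: "\<And>u. s \<le> u \<Longrightarrow> K u < pi / 2"
  shows "(t - s) * cos (K s) \<le> dist (\<gamma> s) (\<gamma> t)"
proof -
  have cos: "cos (K s) > 0" using small[of s] K_nonneg[OF s(1)] by (intro cos_gt_zero_pi) auto
  have "curve_length \<gamma> s t \<le> ereal (dist (\<gamma> s) (\<gamma> t) / cos (K s))"
    unfolding curve_length_def
  proof (rule SUP_least)
    fix ts assume ts: "ts \<in> partitions s t"
    define n where "n = length ts - 1"
    define v where "v i = \<gamma> (ts ! i)" for i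
    define \<rho> where "\<rho> j = pi - vertex_angle (v (j+1)) (v j) (v (j+2))" for j
    have ts_ne: "ts \<noteq> []" using ts by (simp add: partitions_def)
    have ends: "ts ! 0 = s" "ts ! n = t"
      using ts by (auto simp: partitions_def hd_conv_nth last_conv_nth n_def)
    have less: "ts ! i < ts ! j" if "i < j" "j \<le> n" for i j
      using ts that ts_ne by (auto simp: partitions_def sorted_wrt_iff_nth_less n_def)
    have ge: "s \<le> ts ! i" if "i \<le> n" for i
      using less[of 0 i] ends that by (cases "i = 0") auto
    have ne: "v i \<noteq> v j" if "i < j" "j \<le> n" for i j
      unfolding v_def using less[OF that] ge[of i] that s small[of "ts ! i"] pi_gt_zero
      by (intro tail_injective) linarith+
    have \<rho>_nonneg: "0 \<le> \<rho> j" if "j + 2 \<le> n" for j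
      unfolding \<rho>_def using that ne[of j "j+1"] ne[of "j+1" "j+2"]
        vertex_angle_bounds(2)[of "v (j+1)" "v j" "v (j+2)"] by auto
    have rot: "(\<Sum>j<i. \<rho> j) \<le> K s" if "i < n" for i
    proof -
      have "(\<Sum>j<i. \<rho> j) \<le> (\<Sum>j=0..<n-1. \<rho> j)"
        using that by (intro sum_mono2) (auto intro!: \<rho>_nonneg)
      also have "\<dots> \<le> K (ts ! 0)"
        unfolding \<rho>_def v_def using s ends less ne
        by (intro rotation_sum_le) (auto simp: v_def)
      finally show ?thesis by (simp add: ends)
    qed
    have ext: "pi - vertex_angle (v i) (v 0) (v (i+1)) \<le> (\<Sum>j<i. \<rho> j)" if "1 \<le> i" "i < n" for i
      using that
    proof (induction i rule: nat_induct_at_least)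
      case base
      then show ?case by (simp add: \<rho>_def)
    next
      case (Suc i)
      have "pi - vertex_angle (v (Suc i)) (v 0) (v (Suc i + 1)) + comparison_angle (v 0) (v i) (v (Suc i))
        \<le> (pi - vertex_angle (v i) (v 0) (v (Suc i))) + \<rho> i"
        using exterior_angle_step[of "v 0" "v i" "v (Suc i)" "v (Suc i + 1)"] Suc.hyps Suc.prems
          ne[of 0 i] ne[of 0 "Suc i"] ne[of i "Suc i"] ne[of "Suc i" "Suc i + 1"]
        by (simp add: \<rho>_def)
      moreover have "0 \<le> comparison_angle (v 0) (v i) (v (Suc i))"
        using ne[of 0 i] ne[of 0 "Suc i"] Suc.hyps Suc.prems by (intro comparison_angle_bounds) auto
      ultimately show ?case using Suc.IH Suc.prems by simp
    qed
    have "cos (K s) * (\<Sum>j<i. dist (v j) (v (j+1))) \<le> dist (v 0) (v i)" if "i \<le> n" for i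
      using that
    proof (induction i)
      case (Suc i)
      have "dist (v 0) (v i) + dist (v i) (v (Suc i)) * cos (K s) \<le> dist (v 0) (v (Suc i))"
      proof (cases "i = 0")
        \<comment> \<open>The first edge is the segment from \<open>p\<close> itself and adds its full length.\<close>
        case True
        then show ?thesis by (simp add: mult_left_le)
      next
        case False
        let ?u = "pi - vertex_angle (v i) (v 0) (v (Suc i))"
        have "?u \<le> K s" using ext[of i] rot[of i] False Suc.prems by simp
        moreover have "0 \<le> ?u"
          using vertex_angle_bounds[of "v i" "v 0" "v (Suc i)"] ne[of 0 i] ne[of i "Suc i"] False Suc.prems
          by auto
        ultimately have "cos (K s) \<le> cos ?u" using small[of s] by (intro cos_monotone_0_pi_le) auto
        then have "dist (v i) (v (Suc i)) * cos (K s) \<le> dist (v i) (v (Suc i)) * cos ?u"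
          by (rule mult_left_mono) simp
        then show ?thesis
          using dist_step_ge[of "v 0" "v i" "v (Suc i)"] ne[of 0 i] ne[of i "Suc i"] False Suc.prems by simp
      qed
      then show ?case using Suc by (simp add: algebra_simps)
    qed simp
    from this[of n] have "cos (K s) * (\<Sum>j<n. dist (v j) (v (j+1))) \<le> dist (\<gamma> s) (\<gamma> t)"
      by (simp add: v_def ends)
    then show "ereal (\<Sum>i<length ts - 1. dist (\<gamma> (ts ! i)) (\<gamma> (ts ! (i + 1))))
        \<le> ereal (dist (\<gamma> s) (\<gamma> t) / cos (K s))"
      using cos by (simp add: n_def v_def pos_le_divide_eq mult.commute)
  qed
  then show ?thesis
    using arclength s cos by (simp add: arclength_parametrized_def pos_le_divide_eq)
qed

lemma linear_growth: "\<exists>T>0. \<forall>t\<ge>T. (t - T) / 2 \<le> dist (\<gamma> T) (\<gamma> t)"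
proof -
  obtain T where T: "\<And>s. T \<le> s \<Longrightarrow> K s < pi / 3"
    using eventually_K_less[of "pi / 3"] by (auto simp: eventually_at_top_linorder)
  \<comment> \<open>The rotation bound is available from positive times on only.\<close>
  define S where "S = max T 1"
  have S: "0 < S" "\<And>s. S \<le> s \<Longrightarrow> K s < pi / 3" using T by (auto simp: S_def)
  have "1 / 2 \<le> cos (K S)"
    using cos_monotone_0_pi_le[of "K S" "pi / 3"] S K_nonneg[of S] by (simp add: cos_60 less_imp_le)
  moreover have "K u < pi / 2" if "S \<le> u" for u using S(2)[OF that] pi_gt_zero by linarith
  ultimately have "(t - S) / 2 \<le> dist (\<gamma> S) (\<gamma> t)" if "S \<le> t" for t
  proof (cases "t = S")
    case False
    then have "(t - S) * (1 / 2) \<le> (t - S) * cos (K S)"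
      using \<open>1 / 2 \<le> cos (K S)\<close> that by (intro mult_left_mono) auto
    also have "\<dots> \<le> dist (\<gamma> S) (\<gamma> t)"
      using False that S(1) \<open>\<And>u. S \<le> u \<Longrightarrow> K u < pi / 2\<close> by (intro chord_ge_length) auto
    finally show ?thesis by simp
  qed simp
  then show ?thesis using S(1) by blast
qed

lemma eventually_dist_ge: "eventually (\<lambda>t. t / 4 \<le> dist p (\<gamma> t)) at_top"
proof -
  obtain T where T: "\<And>t. T \<le> t \<Longrightarrow> (t - T) / 2 \<le> dist (\<gamma> T) (\<gamma> t)" using linear_growth by blast
  have "t / 4 \<le> dist p (\<gamma> t)" if "t \<ge> T" "t \<ge> 2 * T + 4 * dist p (\<gamma> T)" for t
    using T[OF that(1)] that(2) dist_triangle[of "\<gamma> T" "\<gamma> t" p] by (simp add: dist_commute)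
  then show ?thesis
    by (intro eventually_at_top_linorderI[of "max T (2 * T + 4 * dist p (\<gamma> T))"]) auto
qed

text \<open>A time from which on the curve is injective and avoids \<open>p\<close>.\<close>

definition regular_after :: "'a \<Rightarrow> real \<Rightarrow> bool" where
  "regular_after p T \<longleftrightarrow> 0 < T \<and> (\<forall>u\<ge>T. K u < pi \<and> \<gamma> u \<noteq> p)"

lemma eventually_regular_after: "eventually (regular_after p) at_top"
proof -
  have "eventually (\<lambda>u. K u < pi \<and> \<gamma> u \<noteq> p) at_top"
    using eventually_K_less[of pi, OF pi_gt_zero] eventually_dist_ge[of p] eventually_gt_at_top[of 0]
    by eventually_elim auto
  then obtain T where "\<forall>u\<ge>T. K u < pi \<and> \<gamma> u \<noteq> p" by (auto simp: eventually_at_top_linorder)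
  then show ?thesis
    unfolding regular_after_def
    by (intro eventually_at_top_linorderI[of "max T 1"]) auto
qed

lemma exists_regular_after: "0 < e \<Longrightarrow> \<exists>T. regular_after p T \<and> K T < e"
  using eventually_happens'[OF trivial_limit_at_top_linorder
      eventually_conj[OF eventually_regular_after eventually_K_less]] .

lemma regular_after_avoids:
  assumes "regular_after p T" "T \<le> s"
  shows "p \<noteq> \<gamma> s" "\<gamma> s \<noteq> p"
  using assms by (force simp: regular_after_def)+

lemma regular_after_pos: "regular_after p T \<Longrightarrow> 0 < T"
  by (simp add: regular_after_def)

lemma regular_after_injective:
  assumes "regular_after p T" "T \<le> s" "s < t"
  shows "\<gamma> s \<noteq> \<gamma> t"
  using assms by (intro tail_injective) (auto simp: regular_after_def)

text \<open>
  Iteration of the weighted step from \<open>\<theta> 0\<close>, where the deviation is at most \<open>\<pi>\<close>, to \<open>\<theta> n\<close>, where it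
  bounds the comparison angle at \<open>p\<close> of the last edge.
\<close>

lemma weighted_exterior_angle_le:
  fixes \<theta> :: "nat \<Rightarrow> real"
  assumes reg: "regular_after p (\<theta> 0)" and mono: "\<And>i j. \<lbrakk>i < j; j \<le> Suc n\<rbrakk> \<Longrightarrow> \<theta> i < \<theta> j"
  shows "dist p (\<gamma> (\<theta> n)) * comparison_angle p (\<gamma> (\<theta> n)) (\<gamma> (\<theta> (Suc n)))
    \<le> pi * dist p (\<gamma> (\<theta> 0)) + (\<Sum>j<n. dist p (\<gamma> (\<theta> (j+1))) *
        (pi - vertex_angle (\<gamma> (\<theta> (j+1))) (\<gamma> (\<theta> j)) (\<gamma> (\<theta> (j+2)))))"
proof -
  define v where "v i = \<gamma> (\<theta> i)" for i
  have ge: "\<theta> 0 \<le> \<theta> i" if "i \<le> Suc n" for i using mono[of 0 i] that by (cases "i = 0") auto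
  have p: "p \<noteq> v i" if "i \<le> Suc n" for i
    unfolding v_def using regular_after_avoids[OF reg ge[OF that]] by simp
  have ne: "v i \<noteq> v (Suc i)" if "i \<le> n" for i
    unfolding v_def using that ge[of i] mono[of i "Suc i"] by (intro regular_after_injective[OF reg]) auto
  have "dist p (v i) * (pi - vertex_angle (v i) p (v (Suc i)))
    \<le> pi * dist p (v 0) + (\<Sum>j<i. dist p (v (j+1)) * (pi - vertex_angle (v (j+1)) (v j) (v (j+2))))"
    if "i \<le> n" for i
    using that
  proof (induction i)
    case 0
    have "0 \<le> vertex_angle (v 0) p (v (Suc 0))" using p[of 0] ne[of 0] by (intro vertex_angle_bounds) auto
    then show ?case by (simp add: algebra_simps)
  next
    case (Suc i)
    then show ?case
      using weighted_exterior_angle_step[of p "v i" "v (Suc i)" "v (Suc (Suc i))"]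
        p[of i] p[of "Suc i"] ne[of i] ne[of "Suc i"] by simp
  qed
  from this[of n] have "dist p (v n) * (pi - vertex_angle (v n) p (v (Suc n)))
    \<le> pi * dist p (v 0) + (\<Sum>j<n. dist p (v (j+1)) * (pi - vertex_angle (v (j+1)) (v j) (v (j+2))))"
    by simp
  moreover have "dist p (v n) * comparison_angle p (v n) (v (Suc n))
    \<le> dist p (v n) * (pi - vertex_angle (v n) p (v (Suc n)))"
    using p[of n] p[of "Suc n"] ne[of n]
    by (intro mult_left_mono comparison_angle_le_exterior_angle) auto
  ultimately show ?thesis by (simp add: v_def)
qed

text \<open>
  The polygon with vertices at \<open>T\<close>, \<open>s\<close>, \<open>t\<close> is enough.  What matters is that the bound does not involve
  \<open>t\<close> and that, after division by \<open>d(p, \<gamma> s)\<close>, its first term tends to zero as \<open>s\<close> grows.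
\<close>

lemma radius_times_comparison_angle_le:
  assumes reg: "regular_after p T" and st: "T < s" "s < t"
  shows "dist p (\<gamma> s) * comparison_angle p (\<gamma> s) (\<gamma> t) \<le> pi * dist p (\<gamma> T) + dist p (\<gamma> s) * K T"
proof -
  define \<theta> :: "nat \<Rightarrow> real" where "\<theta> = (\<lambda>i. if i = 0 then T else if i = 1 then s else t)"
  have mono: "\<theta> i < \<theta> j" if "i < j" "j \<le> 2" for i j using that st by (auto simp: \<theta>_def)
  have "dist p (\<gamma> s) * comparison_angle p (\<gamma> s) (\<gamma> t)
      \<le> pi * dist p (\<gamma> T) + dist p (\<gamma> s) * (pi - vertex_angle (\<gamma> s) (\<gamma> T) (\<gamma> t))"
    using weighted_exterior_angle_le[of p \<theta> 1] reg mono by (simp add: \<theta>_def)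
  moreover have "pi - vertex_angle (\<gamma> s) (\<gamma> T) (\<gamma> t) \<le> K T"
  proof -
    have "[\<gamma> T, \<gamma> s, \<gamma> t] \<in> inscribed_polygons \<gamma> T t"
      unfolding inscribed_polygons_def using st
        regular_after_injective[OF reg order_refl st(1)] regular_after_injective[OF reg _ st(2)]
      by (intro CollectI exI[of _ "[T, s, t]"]) (auto simp: partitions_def)
    from total_rotation_le[OF _ this] show ?thesis using reg by (simp add: regular_after_def)
  qed
  ultimately show ?thesis using mult_left_mono[of "pi - vertex_angle (\<gamma> s) (\<gamma> T) (\<gamma> t)" "K T" "dist p (\<gamma> s)"]
    by simp
qed

end

section \<open>Circumradius\<close>

text \<open>
  The least radius exists because the distance from \<open>\<gamma> 0\<close> attains its maximum on \<open>[0, t]\<close>.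
\<close>

lemma circumradius_ge:
  assumes "arclength_parametrized \<gamma>" "0 \<le> t"
  shows "dist (\<gamma> 0) (\<gamma> t) \<le> circumradius \<gamma> t"
proof -
  have "1-lipschitz_on {0..t} \<gamma>"
  proof (rule lipschitz_onI)
    fix u v assume "u \<in> {0..t}" "v \<in> {0..t}"
    then show "dist (\<gamma> u) (\<gamma> v) \<le> 1 * dist u v"
      using arclength_dist_le[OF assms(1), of u v] arclength_dist_le[OF assms(1), of v u]
      by (cases "u \<le> v") (auto simp: dist_commute dist_real_def)
  qed simp
  then have "continuous_on {0..t} (\<lambda>u. dist (\<gamma> 0) (\<gamma> u))"
    by (intro continuous_on_dist continuous_on_const lipschitz_on_continuous_on)
  then obtain m where m: "m \<in> {0..t}" "\<forall>u\<in>{0..t}. dist (\<gamma> 0) (\<gamma> u) \<le> dist (\<gamma> 0) (\<gamma> m)"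
    using continuous_attains_sup[of "{0..t}" "\<lambda>u. dist (\<gamma> 0) (\<gamma> u)"] assms(2) by auto
  have "circumradius \<gamma> t = dist (\<gamma> 0) (\<gamma> m)"
    unfolding circumradius_def
  proof (rule Least_equality)
    show "\<gamma> ` {0..t} \<subseteq> cball (\<gamma> 0) (dist (\<gamma> 0) (\<gamma> m))" using m by auto
    fix r assume "\<gamma> ` {0..t} \<subseteq> cball (\<gamma> 0) r"
    then have "\<gamma> m \<in> cball (\<gamma> 0) r" using m(1) by blast
    then show "dist (\<gamma> 0) (\<gamma> m) \<le> r" by simp
  qed
  then show ?thesis using m assms(2) by simp
qed

context curve_with_small_tail_rotation
begin

lemma circumradius_bigomega: "circumradius \<gamma> \<in> \<Omega>(\<lambda>t. t)"
proof (rule landau_omega.bigI[of "1/4"])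
  show "eventually (\<lambda>t. norm (circumradius \<gamma> t) \<ge> 1/4 * norm t) at_top"
    using eventually_dist_ge[of "\<gamma> 0"] eventually_ge_at_top[of 0]
  proof eventually_elim
    case (elim t)
    then show ?case using circumradius_ge[OF arclength, of t] by simp
  qed
qed simp

section \<open>The limiting ray\<close>

lemma segments_dist_le:
  assumes reg: "regular_after p T" and st: "T < s" "s < t"
    and r: "0 \<le> r" "r \<le> dist p (\<gamma> s)" "r \<le> dist p (\<gamma> t)"
  shows "dist (segment_between p (\<gamma> s) r) (segment_between p (\<gamma> t) r)
    \<le> r * (pi * dist p (\<gamma> T) / dist p (\<gamma> s) + K T)"
proof -
  have ne: "p \<noteq> \<gamma> s" "p \<noteq> \<gamma> t" using regular_after_avoids[OF reg] st by auto
  have "comparison_angle p (\<gamma> s) (\<gamma> t) \<le> pi * dist p (\<gamma> T) / dist p (\<gamma> s) + K T"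
    using radius_times_comparison_angle_le[OF reg st] ne by (simp add: field_simps)
  then have "r * comparison_angle p (\<gamma> s) (\<gamma> t) \<le> r * (pi * dist p (\<gamma> T) / dist p (\<gamma> s) + K T)"
    using r by (intro mult_left_mono)
  then show ?thesis
    using dist_geodesics_same_radius_le[OF geodesic_segment_segment_between
        geodesic_segment_segment_between ne r] by linarith
qed

lemma eventually_dist_ge_const: "eventually (\<lambda>n. r \<le> dist p (\<gamma> (real n))) sequentially"
proof -
  have "eventually (\<lambda>t. r \<le> dist p (\<gamma> t)) at_top"
    using eventually_dist_ge[of p] eventually_ge_at_top[of "4 * r"] by eventually_elim auto
  then show ?thesis by (rule eventually_compose_filterlim[OF _ filterlim_real_sequentially])
qed

text \<open>
  At radius \<open>r\<close> two late segments are at distance at most \<open>r (\<pi> d(p, \<gamma> T) / d(p, \<gamma> s) + K T)\<close>.  First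
  \<open>T\<close> is chosen to make \<open>r K T\<close> small, then \<open>s\<close> to make the other term small.
\<close>

lemma segments_Cauchy:
  assumes r: "0 \<le> r"
  shows "Cauchy (\<lambda>n. segment_between p (\<gamma> (real n)) r)"
proof (rule metric_CauchyI)
  fix e :: real assume e: "e > 0"
  obtain T where T: "regular_after p T" "K T < e / (2 * (r + 1))"
    using exists_regular_after[of "e / (2 * (r + 1))" p] e r by auto
  \<comment> \<open>Beyond radius \<open>R\<close> the term with \<open>d(p, \<gamma> T)\<close> is below \<open>e / 2\<close>.\<close>
  define R where "R = max r (2 * r * pi * dist p (\<gamma> T) / e + 1)"
  have "eventually (\<lambda>n. R \<le> dist p (\<gamma> (real n)) \<and> T < real n) sequentially"
    using eventually_conj[OF eventually_dist_ge_const[of R p]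
      eventually_compose_filterlim[OF eventually_gt_at_top[of T] filterlim_real_sequentially]] .
  then obtain M where M: "\<And>n. n \<ge> M \<Longrightarrow> R \<le> dist p (\<gamma> (real n)) \<and> T < real n"
    by (auto simp: eventually_sequentially)
  have less: "dist (segment_between p (\<gamma> (real m)) r) (segment_between p (\<gamma> (real n)) r) < e"
    if "M \<le> m" "m < n" for m n
  proof -
    have m: "r \<le> dist p (\<gamma> (real m))" "2 * r * pi * dist p (\<gamma> T) / e < dist p (\<gamma> (real m))"
        "T < real m" "0 < dist p (\<gamma> (real m))" and n: "r \<le> dist p (\<gamma> (real n))"
    proof -
      have "R \<le> dist p (\<gamma> (real m))" "R \<le> dist p (\<gamma> (real n))" and T_m: "T < real m"
        using M[of m] M[of n] that by auto
      then show "r \<le> dist p (\<gamma> (real m))" "2 * r * pi * dist p (\<gamma> T) / e < dist p (\<gamma> (real m))"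
        "r \<le> dist p (\<gamma> (real n))" "T < real m"
        unfolding R_def by linarith+
      show "0 < dist p (\<gamma> (real m))" using regular_after_avoids(1)[OF T(1)] T_m by simp
    qed
    have "2 * r * pi * dist p (\<gamma> T) < e * dist p (\<gamma> (real m))"
      using m(2) e by (simp add: pos_divide_less_eq mult.commute)
    then have "2 * r * pi * dist p (\<gamma> T) / dist p (\<gamma> (real m)) < e"
      using m(4) by (simp only: pos_divide_less_eq)
    then have "r * (pi * dist p (\<gamma> T) / dist p (\<gamma> (real m))) < e / 2"
      by (simp add: mult_ac)
    moreover have "r * K T \<le> e / 2"
    proof -
      have "r * K T \<le> r * (e / (2 * (r + 1)))" using T(2) r by (intro mult_left_mono) auto
      also have "\<dots> = (e / 2) * (r / (r + 1))" by simp
      also have "\<dots> \<le> e / 2" using r e by (intro mult_left_le) auto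
      finally show ?thesis .
    qed
    ultimately have "r * (pi * dist p (\<gamma> T) / dist p (\<gamma> (real m)) + K T) < e"
      unfolding distrib_left by linarith
    moreover have "dist (segment_between p (\<gamma> (real m)) r) (segment_between p (\<gamma> (real n)) r)
        \<le> r * (pi * dist p (\<gamma> T) / dist p (\<gamma> (real m)) + K T)"
      using that r m n by (intro segments_dist_le[OF T(1)]) auto
    ultimately show ?thesis by simp
  qed
  show "\<exists>M. \<forall>m\<ge>M. \<forall>n\<ge>M.
      dist (segment_between p (\<gamma> (real m)) r) (segment_between p (\<gamma> (real n)) r) < e"
  proof (intro exI[of _ M] allI impI)
    fix m n assume mn: "m \<ge> M" "n \<ge> M"
    consider "m = n" | "m < n" | "n < m" by linarith
    then show "dist (segment_between p (\<gamma> (real m)) r) (segment_between p (\<gamma> (real n)) r) < e"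
    proof cases
      case 3
      then show ?thesis using less[of n m] mn by (simp only: dist_commute)
    qed (use mn e less in auto)
  qed
qed

definition limit_ray :: "'a \<Rightarrow> (real \<Rightarrow> 'a) \<Rightarrow> bool" where
  "limit_ray p \<sigma> \<longleftrightarrow> (\<forall>r\<ge>0. (\<lambda>n. segment_between p (\<gamma> (real n)) r) \<longlonglongrightarrow> \<sigma> r)"

lemma limit_ray_exists:
  assumes "complete (UNIV :: 'a set)"
  shows "\<exists>\<sigma>. limit_ray p \<sigma>"
proof -
  have "\<exists>l. (\<lambda>n. segment_between p (\<gamma> (real n)) r) \<longlonglongrightarrow> l" if "0 \<le> r" for r
    using assms segments_Cauchy[OF that, of p] unfolding complete_def by blast
  then show ?thesis unfolding limit_ray_def by metis
qed

lemma limit_ray_start: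
  assumes "limit_ray p \<sigma>"
  shows "\<sigma> 0 = p"
proof -
  have "(\<lambda>n. segment_between p (\<gamma> (real n)) 0) \<longlonglongrightarrow> \<sigma> 0" using assms by (simp add: limit_ray_def)
  then show ?thesis unfolding segment_ends by (simp add: LIMSEQ_const_iff)
qed

lemma limit_ray_geodesic:
  assumes "limit_ray p \<sigma>"
  shows "geodesic_ray \<sigma>"
  unfolding geodesic_ray_def
proof (intro allI impI)
  fix s t :: real assume st: "0 \<le> s" "0 \<le> t"
  have "(\<lambda>n. dist (segment_between p (\<gamma> (real n)) s) (segment_between p (\<gamma> (real n)) t))
      \<longlonglongrightarrow> dist (\<sigma> s) (\<sigma> t)"
    using assms st by (intro tendsto_dist) (auto simp: limit_ray_def)
  moreover have "eventually (\<lambda>n. dist (segment_between p (\<gamma> (real n)) s)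
      (segment_between p (\<gamma> (real n)) t) = \<bar>s - t\<bar>) sequentially"
    using eventually_dist_ge_const[of "max s t" p]
    by eventually_elim (use st in \<open>auto intro!: segment_dist\<close>)
  then have "(\<lambda>n. dist (segment_between p (\<gamma> (real n)) s) (segment_between p (\<gamma> (real n)) t))
      \<longlonglongrightarrow> \<bar>s - t\<bar>"
    by (rule tendsto_eventually)
  ultimately show "dist (\<sigma> s) (\<sigma> t) = \<bar>s - t\<bar>" by (rule LIMSEQ_unique)
qed

text \<open>
  The point \<open>\<gamma> s\<close> lies on its segment from \<open>p\<close> at radius \<open>d(p, \<gamma> s)\<close>, and the bound \<open>C\<close> holds for the
  distance to the points at the same radius on all later segments, hence for the limit.
\<close>

lemma dist_to_limit_ray_le:
  assumes ray: "limit_ray p \<sigma>" and s: "p \<noteq> \<gamma> s"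
    and le: "\<And>t. s < t \<Longrightarrow> p \<noteq> \<gamma> t \<and> dist p (\<gamma> s) * comparison_angle p (\<gamma> s) (\<gamma> t) \<le> C"
  shows "dist_to_ray (\<gamma> s) \<sigma> \<le> C"
proof -
  let ?r = "dist p (\<gamma> s)"
  have "eventually (\<lambda>n. s < real n) sequentially"
    by (rule eventually_compose_filterlim[OF eventually_gt_at_top filterlim_real_sequentially])
  then have "eventually (\<lambda>n. dist (\<gamma> s) (segment_between p (\<gamma> (real n)) ?r) \<le> C) sequentially"
    using eventually_dist_ge_const[of ?r p]
  proof eventually_elim
    case (elim n)
    have "dist (segment_between p (\<gamma> s) ?r) (segment_between p (\<gamma> (real n)) ?r)
        \<le> ?r * comparison_angle p (\<gamma> s) (\<gamma> (real n))"
      using elim s le by (intro dist_geodesics_same_radius_le geodesic_segment_segment_between) auto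
    also have "\<dots> \<le> C" using le[of "real n"] elim by simp
    finally show ?case by (simp add: segment_ends)
  qed
  moreover have "(\<lambda>n. dist (\<gamma> s) (segment_between p (\<gamma> (real n)) ?r)) \<longlonglongrightarrow> dist (\<gamma> s) (\<sigma> ?r)"
    using ray by (intro tendsto_dist tendsto_const) (auto simp: limit_ray_def)
  ultimately have "dist (\<gamma> s) (\<sigma> ?r) \<le> C" by (intro tendsto_upperbound) auto
  moreover have "infdist (\<gamma> s) (\<sigma> ` {0..}) \<le> dist (\<gamma> s) (\<sigma> ?r)" by (intro infdist_le) auto
  ultimately show ?thesis by (simp add: dist_to_ray_def)
qed

lemma limit_ray_sublinear:
  assumes ray: "limit_ray p \<sigma>"
  shows "(\<lambda>t. dist_to_ray (\<gamma> t) \<sigma>) \<in> o(\<lambda>t. t)"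
proof (rule landau_o.smallI)
  fix c :: real assume c: "c > 0"
  obtain T where T: "regular_after p T" "K T < c / 2"
    using exists_regular_after[of "c / 2" p] c by auto
  have T0: "0 < T" "0 \<le> K T" using regular_after_pos[OF T(1)] K_nonneg by auto
  define D where "D = dist p (\<gamma> T)"
  show "eventually (\<lambda>t. norm (dist_to_ray (\<gamma> t) \<sigma>) \<le> c * norm t) at_top"
    using eventually_gt_at_top[of T] eventually_ge_at_top[of "2 * (pi * D + D * K T) / c"]
  proof eventually_elim
    case (elim s)
    have "dist_to_ray (\<gamma> s) \<sigma> \<le> pi * D + dist p (\<gamma> s) * K T"
      unfolding D_def using elim regular_after_avoids[OF T(1)]
      by (intro dist_to_limit_ray_le[OF ray] conjI radius_times_comparison_angle_le[OF T(1)]) auto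
    also have "\<dots> \<le> pi * D + (D + s) * K T"
    proof -
      have "dist p (\<gamma> s) \<le> D + s"
        using dist_le[of T s] dist_triangle[of p "\<gamma> s" "\<gamma> T"] elim T0 by (simp add: D_def)
      then show ?thesis using T0 by (intro add_left_mono mult_right_mono) auto
    qed
    also have "\<dots> \<le> c * s"
    proof -
      have "pi * D + D * K T \<le> (c / 2) * s" using elim(2) c by (simp add: field_simps)
      moreover have "s * K T \<le> s * (c / 2)" using T(2) elim T0 by (intro mult_left_mono) auto
      ultimately show ?thesis by (simp add: algebra_simps)
    qed
    finally show ?case
      using elim T0 by (simp add: dist_to_ray_def infdist_nonneg)
  qed
qed

text \<open>
  A ray at sublinear distance from \<open>\<gamma>\<close> is the limit of the segments from its own starting point:
  radial contraction towards \<open>p\<close> brings the distance of order \<open>o(t)\<close> between \<open>\<gamma> t\<close> and a point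
  of \<open>\<sigma>\<close> down to \<open>o(1)\<close> at a fixed radius.
\<close>

lemma sublinear_ray_is_limit_ray:
  assumes ray: "geodesic_ray \<sigma>" and small: "(\<lambda>t. dist_to_ray (\<gamma> t) \<sigma>) \<in> o(\<lambda>t. t)"
  shows "limit_ray (\<sigma> 0) \<sigma>"
  unfolding limit_ray_def
proof (intro allI impI metric_LIMSEQ_I)
  fix r e :: real assume r: "0 \<le> r" and e: "0 < e"
  let ?p = "\<sigma> 0"
  \<comment> \<open>The first bound keeps the error below the radius \<open>d(p, \<gamma> t) \<ge> t / 4\<close>; the second one makes the
    error \<open>4 c t\<close>, contracted by \<open>r / d(p, \<gamma> t)\<close>, smaller than \<open>e\<close>.\<close>
  define c where "c = min (1 / 16) (e / (16 * (r + 1)))"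
  have c: "c > 0" using e r by (simp add: c_def)
  have c16: "c \<le> 1 / 16" unfolding c_def by (rule min.cobounded1)
  have "eventually (\<lambda>t. dist (segment_between ?p (\<gamma> t) r) (\<sigma> r) < e) at_top"
    using eventually_gt_at_top[of 0] eventually_dist_ge[of ?p] eventually_ge_at_top[of "4 * r"]
      landau_o.smallD[OF small c]
  proof eventually_elim
    case (elim t)
    let ?R = "dist ?p (\<gamma> t)"
    have "infdist (\<gamma> t) (\<sigma> ` {0..}) \<le> c * t" "0 < c * t"
      using elim(1,4) c by (simp_all add: dist_to_ray_def infdist_nonneg)
    then have "infdist (\<gamma> t) (\<sigma> ` {0..}) < 2 * c * t" by simp
    then obtain \<rho> where \<rho>: "0 \<le> \<rho>" "dist (\<gamma> t) (\<sigma> \<rho>) < 2 * c * t"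
      using cInf_lessD[of "dist (\<gamma> t) ` \<sigma> ` {0..}" "2 * c * t"] by (auto simp: infdist_notempty)
    have d\<rho>: "dist ?p (\<sigma> \<rho>) = \<rho>" using ray \<rho> by (simp add: geodesic_ray_def)
    have "\<bar>?R - \<rho>\<bar> \<le> dist (\<gamma> t) (\<sigma> \<rho>)"
      using d\<rho> abs_dist_diff_le[of "\<gamma> t" ?p "\<sigma> \<rho>"] by (simp add: dist_commute)
    then have close: "\<bar>?R - \<rho>\<bar> < 2 * c * t" using \<rho>(2) by linarith
    have "c * t \<le> 1 / 16 * t" using c16 elim(1) by (intro mult_right_mono) auto
    then have "2 * c * t \<le> t / 8" by simp
    then have R: "0 < \<rho>" "0 < ?R" "r \<le> ?R" "t / 4 \<le> ?R"
      using close elim(1,2,3) by linarith+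
    define k where "k = r / ?R"
    have k: "0 \<le> k" "k \<le> 1" "k * ?R = r" using r R by (auto simp: k_def)
    have "geodesic_segment \<sigma> ?p (\<sigma> \<rho>)"
      using ray \<rho> d\<rho> by (auto simp: geodesic_segment_def geodesic_ray_def)
    then have "dist (segment_between ?p (\<gamma> t) (k * ?R)) (\<sigma> (k * dist ?p (\<sigma> \<rho>))) \<le> k * dist (\<gamma> t) (\<sigma> \<rho>)"
      using k(1,2) R(1,2) d\<rho>
      by (intro dist_geodesics_le_proportional geodesic_segment_segment_between) auto
    moreover have "dist (\<sigma> (k * \<rho>)) (\<sigma> r) = k * \<bar>?R - \<rho>\<bar>"
    proof -
      have "dist (\<sigma> (k * \<rho>)) (\<sigma> r) = \<bar>k * \<rho> - k * ?R\<bar>"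
        unfolding k(3) using ray r k(1) \<rho>(1) by (simp add: geodesic_ray_def)
      also have "\<dots> = \<bar>k\<bar> * \<bar>\<rho> - ?R\<bar>" unfolding right_diff_distrib[symmetric] abs_mult ..
      also have "\<dots> = k * \<bar>?R - \<rho>\<bar>" using k(1) by (simp only: abs_of_nonneg abs_minus_commute)
      finally show ?thesis .
    qed
    ultimately have "dist (segment_between ?p (\<gamma> t) r) (\<sigma> r) \<le> k * (dist (\<gamma> t) (\<sigma> \<rho>) + \<bar>?R - \<rho>\<bar>)"
      using dist_triangle[of "segment_between ?p (\<gamma> t) r" "\<sigma> r" "\<sigma> (k * \<rho>)"]
      unfolding d\<rho> k(3) by (simp add: distrib_left)
    also have "\<dots> \<le> k * (4 * c * t)" using \<rho>(2) close k(1) by (intro mult_left_mono) auto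
    also have "\<dots> \<le> 16 * (r * c)"
    proof -
      have "k * t \<le> k * (4 * ?R)" using R(4) k(1) by (intro mult_left_mono) auto
      also have "\<dots> = 4 * r" using k(3) by simp
      finally have "4 * c * (k * t) \<le> 4 * c * (4 * r)" using c by (intro mult_left_mono) auto
      then show ?thesis by (simp add: mult_ac)
    qed
    also have "\<dots> \<le> 16 * (r * (e / (16 * (r + 1))))"
      using r by (intro mult_left_mono) (auto simp: c_def)
    also have "\<dots> = e * (r / (r + 1))"
    proof -
      have "16 * (r * (e / (16 * q))) = e * (r / q)" for q :: real by simp
      then show ?thesis .
    qed
    also have "\<dots> < e * 1" using r e by (intro mult_strict_left_mono) auto
    also have "\<dots> = e" by simp
    finally show ?case .
  qed
  then have "eventually (\<lambda>n. dist (segment_between ?p (\<gamma> (real n)) r) (\<sigma> r) < e) sequentially"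
    by (rule eventually_compose_filterlim[OF _ filterlim_real_sequentially])
  then show "\<exists>M. \<forall>n\<ge>M. dist (segment_between ?p (\<gamma> (real n)) r) (\<sigma> r) < e"
    by (simp add: eventually_sequentially)
qed

end

section \<open>Summable tail rotation\<close>

lemma sum_weighted_eq_sum_tails:
  fixes \<rho> :: "nat \<Rightarrow> real"
  shows "(\<Sum>j<n. real (j + 1) * \<rho> j) = (\<Sum>k<n. \<Sum>j=k..<n. \<rho> j)"
proof (induction n)
  case (Suc n)
  have "(\<Sum>k<n. \<Sum>j=k..<Suc n. \<rho> j) = (\<Sum>k<n. (\<Sum>j=k..<n. \<rho> j) + \<rho> n)"
    by (intro sum.cong) auto
  then show ?case using Suc by (simp add: sum.distrib algebra_simps)
qed simp

text \<open>
  A decreasing function dominates on \<open>[T + i, T + i + 1)\<close> its value at the right end.  The comparison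
  is with a step function.
\<close>

lemma sum_bounded_by_nn_integral:
  fixes k :: "real \<Rightarrow> real"
  assumes anti: "\<And>s t. \<lbrakk>0 \<le> s; s \<le> t\<rbrakk> \<Longrightarrow> k t \<le> k s" and nonneg: "\<And>t. 0 \<le> t \<Longrightarrow> 0 \<le> k t"
    and fin: "(\<integral>\<^sup>+t\<in>{0..}. ennreal (k t) \<partial>lborel) < \<infinity>" and T: "0 \<le> T"
  shows "\<exists>B. \<forall>n. (\<Sum>i<n. k (T + real i)) \<le> B"
proof -
  let ?I = "\<integral>\<^sup>+t\<in>{0..}. ennreal (k t) \<partial>lborel"
  define A where "A i = {T + real i..<T + real (Suc i)}" for i
  have "i = j" if "t \<in> A i" "t \<in> A j" for i j t
  proof -
    have "real i < real (Suc j)" "real j < real (Suc i)" using that by (auto simp: A_def)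
    then show ?thesis unfolding of_nat_less_iff by simp
  qed
  then have disj: "disjoint_family_on A {..<n}" for n unfolding disjoint_family_on_def by blast
  have emeasure: "emeasure lborel (A i) = 1" for i by (simp add: A_def)
  have sum: "(\<Sum>i<n. k (T + real (Suc i))) \<le> enn2real ?I" for n
  proof -
    have "(\<Sum>i<n. ennreal (k (T + real (Suc i))) * indicator (A i) t) \<le> ennreal (k t) * indicator {0..} t" for t
    proof (cases "\<exists>j<n. t \<in> A j")
      case True
      then obtain j where j: "j < n" "t \<in> A j" by blast
      have "(\<Sum>i<n. ennreal (k (T + real (Suc i))) * indicator (A i) t) = ennreal (k (T + real (Suc j)))"
        using j by (intro sum_indicator_disjoint_family[OF disj]) auto
      also have "\<dots> \<le> ennreal (k t)" using j(2) T by (intro ennreal_leI anti) (auto simp: A_def)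
      finally show ?thesis using j(2) T by (simp add: A_def)
    next
      case False
      then have "(\<Sum>i<n. ennreal (k (T + real (Suc i))) * indicator (A i) t) = 0"
        by (intro sum.neutral) (auto simp: indicator_def)
      then show ?thesis by simp
    qed
    then have "(\<integral>\<^sup>+t. (\<Sum>i<n. ennreal (k (T + real (Suc i))) * indicator (A i) t) \<partial>lborel) \<le> ?I"
      by (intro nn_integral_mono)
    also have "(\<integral>\<^sup>+t. (\<Sum>i<n. ennreal (k (T + real (Suc i))) * indicator (A i) t) \<partial>lborel)
        = (\<Sum>i<n. ennreal (k (T + real (Suc i))))"
    proof (subst nn_integral_sum)
      have meas: "A i \<in> sets lborel" for i by (simp add: A_def)
      then show "(\<lambda>t. ennreal (k (T + real (Suc i))) * indicator (A i) t) \<in> borel_measurable lborel" for i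
        by (intro borel_measurable_times_ennreal borel_measurable_const borel_measurable_indicator)
      show "(\<Sum>i<n. \<integral>\<^sup>+t. ennreal (k (T + real (Suc i))) * indicator (A i) t \<partial>lborel)
          = (\<Sum>i<n. ennreal (k (T + real (Suc i))))"
        by (simp only: nn_integral_cmult_indicator[OF meas] emeasure mult_1_right)
    qed
    also have "\<dots> = ennreal (\<Sum>i<n. k (T + real (Suc i)))"
      using T by (intro sum_ennreal nonneg) auto
    also have "?I = ennreal (enn2real ?I)" using fin by (simp add: less_top)
    finally show ?thesis unfolding ennreal_le_iff[OF enn2real_nonneg] .
  qed
  have "(\<Sum>i<n. k (T + real i)) \<le> k T + enn2real ?I" for n
  proof (cases n)
    case (Suc m)
    have "(\<Sum>i<n. k (T + real i)) = k (T + real 0) + (\<Sum>i<m. k (T + real (Suc i)))"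
      unfolding Suc by (rule sum.lessThan_Suc_shift)
    then show ?thesis using sum[of m] by simp
  qed (use nonneg[OF T] in \<open>simp add: enn2real_nonneg\<close>)
  then show ?thesis by blast
qed

context curve_with_small_tail_rotation
begin

text \<open>
  At the vertex \<open>\<theta> j\<close> the radius is at most \<open>D + j\<close>, so the weighted sum of the rotations is at most
  \<open>D\<close> times the total rotation plus \<open>\<Sum> j \<rho>\<^sub>j\<close>, and the latter is the sum over \<open>k\<close> of the rotations of the
  tails starting at \<open>T + k\<close>.  The final time \<open>t\<close> contributes nothing to the bound, and so it
  survives the passage to the limit ray.
\<close>

lemma dist_to_limit_ray_bounded:
  assumes ray: "limit_ray p \<sigma>"
    and sums: "\<And>T. 0 < T \<Longrightarrow> \<exists>B. \<forall>n. (\<Sum>k<n. K (T + real k)) \<le> B"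
  shows "bounded ((\<lambda>t. dist_to_ray (\<gamma> t) \<sigma>) ` {0..})"
proof -
  obtain T where T: "regular_after p T" using exists_regular_after[of 1 p] by auto
  have T0: "0 < T" using T by (rule regular_after_pos)
  obtain B where B: "\<And>n. (\<Sum>k<n. K (T + real k)) \<le> B" using sums[OF T0] by blast
  have B0: "0 \<le> B" using B[of 0] by simp
  define D where "D = dist p (\<gamma> T)"
  define C where "C = pi * D + (D * K T + B)"
  have C0: "0 \<le> C" using B0 K_nonneg[OF T0] by (simp add: C_def D_def)
  have node: "dist_to_ray (\<gamma> (T + real n)) \<sigma> \<le> C" for n
  proof (rule dist_to_limit_ray_le[OF ray])
    show "p \<noteq> \<gamma> (T + real n)" using regular_after_avoids[OF T] by simp
    fix t assume t: "T + real n < t"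
    define \<theta> where "\<theta> i = (if i \<le> n then T + real i else t)" for i
    have mono: "\<theta> i < \<theta> j" if "i < j" "j \<le> Suc n" for i j
    proof (cases "j \<le> n")
      case False
      then have "i \<le> n" using that by simp
      then have "T + real i \<le> T + real n" by simp
      then show ?thesis using False \<open>i \<le> n\<close> t by (simp add: \<theta>_def)
    qed (use that in \<open>auto simp: \<theta>_def\<close>)
    have ge: "T \<le> \<theta> i" if "i \<le> Suc n" for i using t by (auto simp: \<theta>_def)
    have ne: "\<gamma> (\<theta> i) \<noteq> \<gamma> (\<theta> j)" if "i < j" "j \<le> Suc n" for i j
      using mono[OF that] ge[of i] that by (intro regular_after_injective[OF T]) auto
    define \<rho> where "\<rho> j = pi - vertex_angle (\<gamma> (\<theta> (j+1))) (\<gamma> (\<theta> j)) (\<gamma> (\<theta> (j+2)))" for j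
    have \<rho>_nonneg: "0 \<le> \<rho> j" if "j < n" for j
      unfolding \<rho>_def using that ne[of j "j+1"] ne[of "j+1" "j+2"]
        vertex_angle_bounds(2)[of "\<gamma> (\<theta> (j+1))" "\<gamma> (\<theta> j)" "\<gamma> (\<theta> (j+2))"] by auto
    have tail: "(\<Sum>j=k..<n. \<rho> j) \<le> K (T + real k)" if "k < n" for k
    proof -
      have "0 < \<theta> k" using ge[of k] T0 that by simp
      then have "(\<Sum>j=k..<Suc n - 1. \<rho> j) \<le> K (\<theta> k)"
        unfolding \<rho>_def using that mono ne by (intro rotation_sum_le) auto
      then show ?thesis using that by (simp add: \<theta>_def)
    qed
    have "dist p (\<gamma> (\<theta> n)) * comparison_angle p (\<gamma> (\<theta> n)) (\<gamma> (\<theta> (Suc n)))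
        \<le> pi * dist p (\<gamma> (\<theta> 0)) + (\<Sum>j<n. dist p (\<gamma> (\<theta> (j+1))) * \<rho> j)"
      unfolding \<rho>_def using T mono by (intro weighted_exterior_angle_le) (auto simp: \<theta>_def)
    also have "(\<Sum>j<n. dist p (\<gamma> (\<theta> (j+1))) * \<rho> j) \<le> (\<Sum>j<n. (D + real (j+1)) * \<rho> j)"
    proof (intro sum_mono mult_right_mono)
      fix j assume "j \<in> {..<n}"
      then show "dist p (\<gamma> (\<theta> (j+1))) \<le> D + real (j+1)"
        using dist_triangle[of p "\<gamma> (T + real (j+1))" "\<gamma> T"] dist_le[of T "T + real (j+1)"] T0
        by (simp add: \<theta>_def D_def)
    qed (use \<rho>_nonneg in auto)
    also have "\<dots> = D * (\<Sum>j=0..<n. \<rho> j) + (\<Sum>k<n. \<Sum>j=k..<n. \<rho> j)"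
      by (simp only: distrib_right sum.distrib sum_distrib_left sum_weighted_eq_sum_tails atLeast0LessThan)
    also have "\<dots> \<le> D * K T + (\<Sum>k<n. K (T + real k))"
    proof (intro add_mono mult_left_mono sum_mono)
      show "(\<Sum>j=0..<n. \<rho> j) \<le> K T"
        using tail[of 0] K_nonneg[OF T0] by (cases "n = 0") auto
    qed (use tail in \<open>auto simp: D_def\<close>)
    also have "\<dots> \<le> D * K T + B" using B[of n] by simp
    finally have "dist p (\<gamma> (\<theta> n)) * comparison_angle p (\<gamma> (\<theta> n)) (\<gamma> (\<theta> (Suc n))) \<le> C"
      by (simp add: C_def D_def \<theta>_def)
    then show "p \<noteq> \<gamma> t \<and> dist p (\<gamma> (T + real n)) * comparison_angle p (\<gamma> (T + real n)) (\<gamma> t) \<le> C"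
      using regular_after_avoids[OF T] t by (simp add: \<theta>_def)
  qed
  have "dist_to_ray (\<gamma> t) \<sigma> \<le> C + T + 1" if t: "0 \<le> t" for t
  proof -
    obtain n where n: "\<bar>t - (T + real n)\<bar> \<le> T + 1"
    proof (cases "t \<le> T")
      case True
      then show ?thesis using that[of 0] t by auto
    next
      case False
      then have "\<bar>t - (T + real (nat \<lfloor>t - T\<rfloor>))\<bar> \<le> T + 1" using T0 by simp linarith
      then show ?thesis by (rule that)
    qed
    have "dist_to_ray (\<gamma> t) \<sigma> \<le> dist_to_ray (\<gamma> (T + real n)) \<sigma> + dist (\<gamma> t) (\<gamma> (T + real n))"
      unfolding dist_to_ray_def by (rule infdist_triangle)
    moreover have "dist (\<gamma> t) (\<gamma> (T + real n)) \<le> T + 1"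
      using dist_le[of t "T + real n"] dist_le[of "T + real n" t] n t T0
      by (cases "t \<le> T + real n") (auto simp: dist_commute)
    ultimately show ?thesis using node[of n] by simp
  qed
  then show ?thesis
    unfolding bounded_iff by (intro exI[of _ "C + T + 1"]) (auto simp: dist_to_ray_def infdist_nonneg)
qed

end

theorem theorem6:
  fixes \<gamma> :: "real \<Rightarrow> 'a::cat0_space" and \<tau>\<^sub>\<gamma> :: real
  assumes "arclength_parametrized \<gamma>"
    and "((\<lambda>t. total_curvature \<gamma> 0 t) \<longlongrightarrow> ereal \<tau>\<^sub>\<gamma>) at_top"
  shows
    "(complete (UNIV :: 'a set) \<longrightarrow>
        (\<forall>p. \<exists>\<sigma>. geodesic_ray \<sigma> \<and> \<sigma> 0 = p \<and> (\<lambda>t. dist_to_ray (\<gamma> t) \<sigma>) \<in> o(\<lambda>t. t)))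
     \<and> circumradius \<gamma> \<in> \<Omega>(\<lambda>t. t)
     \<and> ((\<integral>\<^sup>+t\<in>{0..}. e2ennreal (ereal \<tau>\<^sub>\<gamma> - total_curvature \<gamma> 0 t) \<partial>lborel) < \<infinity> \<longrightarrow>
        (\<forall>\<sigma>. geodesic_ray \<sigma> \<and> (\<lambda>t. dist_to_ray (\<gamma> t) \<sigma>) \<in> o(\<lambda>t. t) \<longrightarrow>
             bounded ((\<lambda>t. dist_to_ray (\<gamma> t) \<sigma>) ` {0..})))"
proof -
  define K where "K s = \<tau>\<^sub>\<gamma> - real_of_ereal (total_curvature \<gamma> 0 s)" for s
  interpret curve_with_small_tail_rotation \<gamma> K
  proof
    show "total_rotation vs \<le> K s" if "0 < s" "vs \<in> inscribed_polygons \<gamma> s t" for s t vs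
      unfolding K_def using that by (intro total_rotation_le_remaining_curvature[OF assms]) auto
    show "(K \<longlongrightarrow> 0) at_top"
      unfolding K_def using tendsto_diff[OF tendsto_const lim_real_of_ereal[OF assms(2)], of \<tau>\<^sub>\<gamma>] by simp
  qed (rule assms(1))
  have K: "total_curvature \<gamma> 0 t = ereal (\<tau>\<^sub>\<gamma> - K t)" "0 \<le> K t" if "0 \<le> t" for t
  proof -
    have "0 \<le> total_curvature \<gamma> 0 t" "total_curvature \<gamma> 0 t \<le> ereal \<tau>\<^sub>\<gamma>"
      using total_curvature_nonneg[OF assms(1) order_refl that] total_curvature_le_limit[OF assms that]
      by simp_all
    then obtain r where "total_curvature \<gamma> 0 t = ereal r" "r \<le> \<tau>\<^sub>\<gamma>"
      by (cases "total_curvature \<gamma> 0 t") auto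
    then show "total_curvature \<gamma> 0 t = ereal (\<tau>\<^sub>\<gamma> - K t)" "0 \<le> K t" by (simp_all add: K_def)
  qed
  have K_anti: "K t \<le> K s" if "0 \<le> s" "s \<le> t" for s t
    using total_curvature_mono[OF assms(1) that] K(1)[of s] K(1)[of t] that by simp
  have a: "\<exists>\<sigma>. geodesic_ray \<sigma> \<and> \<sigma> 0 = p \<and> (\<lambda>t. dist_to_ray (\<gamma> t) \<sigma>) \<in> o(\<lambda>t. t)"
    if complete: "complete (UNIV :: 'a set)" for p
  proof -
    obtain \<sigma> where "limit_ray p \<sigma>" using limit_ray_exists[OF complete] by blast
    then show ?thesis
      by (intro exI[of _ \<sigma>] conjI limit_ray_geodesic limit_ray_start limit_ray_sublinear)
  qed
  have c: "bounded ((\<lambda>t. dist_to_ray (\<gamma> t) \<sigma>) ` {0..})"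
    if fin: "(\<integral>\<^sup>+t\<in>{0..}. e2ennreal (ereal \<tau>\<^sub>\<gamma> - total_curvature \<gamma> 0 t) \<partial>lborel) < \<infinity>"
      and \<sigma>: "geodesic_ray \<sigma>" "(\<lambda>t. dist_to_ray (\<gamma> t) \<sigma>) \<in> o(\<lambda>t. t)" for \<sigma>
  proof (rule dist_to_limit_ray_bounded[OF sublinear_ray_is_limit_ray[OF \<sigma>]])
    fix T :: real assume T: "0 < T"
    have "(\<integral>\<^sup>+t\<in>{0..}. ennreal (K t) \<partial>lborel)
        = (\<integral>\<^sup>+t\<in>{0..}. e2ennreal (ereal \<tau>\<^sub>\<gamma> - total_curvature \<gamma> 0 t) \<partial>lborel)"
      by (intro nn_integral_cong) (auto simp: K(1) indicator_def)
    then show "\<exists>B. \<forall>n. (\<Sum>k<n. K (T + real k)) \<le> B"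
      using fin T K(2) K_anti by (intro sum_bounded_by_nn_integral) auto
  qed
  show ?thesis by (intro conjI impI allI a circumradius_bigomega c) auto
qed

end
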